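(* Suppose that $f\in\mathcal{S}_H^{0}$ is a $K$-quasiconformal harmonic mapping of $\mathbb{D}$ onto a bounded domain $f(\mathbb{D})$ for some $K\geq1$, and that $$\limsup_{|z|\to1^-}\left\{(1-|z|^2)\,\mathrm{Re}\big(zP_f(z)\big)\right\}<1 .$$ If $\ell\big(f([0,z])\big)<\infty$ for all $z\in\mathbb{D}$, then $f(\mathbb{D})$ is a radial John disk (with respect to $f$).
   Context: $\mathbb{D}$ is the open unit disk in $\mathbb{C}$. A harmonic mapping in $\mathbb{D}$ is a complex-valued function whose real and imaginary parts are real harmonic; it can be written $f=h+\overline{g}$ with $h,g$ analytic, unique with $g(0)=0$. $\mathcal{S}_H$ is the family of sense-preserving univalent harmonic mappings $f=h+\overline{g}$ in $\mathbb{D}$ with $h(0)=g(0)=0$, $h'(0)=1$; $\mathcal{S}_H^{0}$ is the subfamily with $g'(0)=0$. With $\omega=g'/h'$ (so $|\omega|<1$ in $\mathbb{D}$), the pre-Schwarzian derivative of $f=h+\overline g$ is $$P_f=\frac{h''}{h'}-\frac{\omega'\,\overline{\omega}}{1-|\omega|^2}.$$ $\|D_f\|=|f_z|+|f_{\overline z}|$, $l(D_f)=\big||f_z|-|f_{\overline z}|\big|$, where $f_z=\frac12(f_x-if_y)$, $f_{\overline z}=\frac12(f_x+if_y)$; $\det D_f=|f_z|^2-|f_{\overline z}|^2$. For $K\ge1$, a sense-preserving homeomorphism $f$ of a domain $\Omega_0$ onto a domain $\Omega_0'$, in the Sobolev class $W^{1,2}_{loc}(\Omega_0)$, is $K$-quasiconformal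 if $\|D_f(z)\|^2\le K\det D_f(z)$, i.e. $\|D_f(z)\|\le K\,l(D_f(z))$, for $z\in\Omega_0$. $\ell$ denotes Euclidean length, $[0,z]$ the line segment from $0$ to $z$, and $d_G(w)$ the Euclidean distance from $w$ to $\partial G$. Radial John disk: for a univalent map $f$ on $\mathbb{D}$ with bounded simply connected image $G=f(\mathbb{D})$, $G$ is a radial $c$-John disk ($c\ge1$), with John center $w_0=f(0)$, if for each $w_1=f(z_1)\in G$, $z_1\in\mathbb{D}$, the curve $\gamma=f([0,z_1])$ is rectifiable and satisfies $\sigma_\ell(w)\le c\,d_G(w)$ for all $w$ on $\gamma$, where $\sigma_\ell(w)$ is the Euclidean length of the subarc $\gamma[w_1,w]$ of $\gamma$ between $w_1$ and $w$. $G$ is a radial John disk if it is a radial $c$-John disk for some $c\ge1$. *)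

theory Defs
  imports "HOL-Complex_Analysis.Complex_Analysis"
begin

text \<open>
  The plane is the type \<^typ>\<open>complex\<close>, and the unit disk is \<^term>\<open>ball 0 1\<close>.
  A mapping of the disk is a total function of which only the values on the disk matter.
\<close>

subsection \<open>Partial derivatives and harmonic mappings\<close>

text \<open>The direction \<open>v\<close> is \<open>1\<close> for the x-derivative and \<open>\<i>\<close> for the y-derivative.\<close>

definition pderiv_along :: "complex \<Rightarrow> (complex \<Rightarrow> 'a::real_normed_vector) \<Rightarrow> complex \<Rightarrow> 'a" where
  "pderiv_along v f z = vector_derivative (\<lambda>t::real. f (z + of_real t * v)) (at 0)"

text \<open>\<open>k\<close> times continuously differentiable in the real sense; \<open>S\<close> is meant to be open.\<close>

primrec Ck_on :: "nat \<Rightarrow> complex set \<Rightarrow> (complex \<Rightarrow> 'a::real_normed_vector) \<Rightarrow> bool" where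
  "Ck_on 0 S f \<longleftrightarrow> continuous_on S f"
| "Ck_on (Suc k) S f \<longleftrightarrow> (\<forall>z\<in>S. f differentiable (at z)) \<and>
     Ck_on k S (pderiv_along 1 f) \<and> Ck_on k S (pderiv_along \<i> f)"

definition real_harmonic_on :: "complex set \<Rightarrow> (complex \<Rightarrow> real) \<Rightarrow> bool" where
  "real_harmonic_on S u \<longleftrightarrow> Ck_on 2 S u \<and>
     (\<forall>z\<in>S. pderiv_along 1 (pderiv_along 1 u) z + pderiv_along \<i> (pderiv_along \<i> u) z = 0)"

definition harmonic_mapping_on :: "complex set \<Rightarrow> (complex \<Rightarrow> complex) \<Rightarrow> bool" where
  "harmonic_mapping_on S f \<longleftrightarrow>
     real_harmonic_on S (\<lambda>z. Re (f z)) \<and> real_harmonic_on S (\<lambda>z. Im (f z))"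

text \<open>
  The representation \<open>f = h + cnj g\<close> in the unit disk. The condition \<open>g 0 = 0\<close> makes
  \<open>h\<close> and \<open>g\<close> unique on the disk.
\<close>

definition canonical_rep ::
    "(complex \<Rightarrow> complex) \<Rightarrow> (complex \<Rightarrow> complex) \<Rightarrow> (complex \<Rightarrow> complex) \<Rightarrow> bool" where
  "canonical_rep f h g \<longleftrightarrow> h holomorphic_on ball 0 1 \<and> g holomorphic_on ball 0 1 \<and> g 0 = 0 \<and>
     (\<forall>z\<in>ball 0 1. f z = h z + cnj (g z))"

text \<open>
  Topological orientation (for continuous injective \<open>f\<close>, not assumed differentiable): the image
  of a positively oriented circle winds once, positively, around the image of its centre.
\<close>

definition sense_preserving_on :: "complex set \<Rightarrow> (complex \<Rightarrow> complex) \<Rightarrow> bool" where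
  "sense_preserving_on S f \<longleftrightarrow>
     (\<forall>z r. 0 < r \<and> cball z r \<subseteq> S \<longrightarrow> winding_number (f \<circ> circlepath z r) (f z) = 1)"

definition S_H :: "(complex \<Rightarrow> complex) set" where
  "S_H = {f. harmonic_mapping_on (ball 0 1) f \<and> inj_on f (ball 0 1) \<and>
     sense_preserving_on (ball 0 1) f \<and>
     (\<exists>h g. canonical_rep f h g \<and> h 0 = 0 \<and> deriv h 0 = 1)}"

definition S_H0 :: "(complex \<Rightarrow> complex) set" where
  "S_H0 = {f \<in> S_H. \<exists>h g. canonical_rep f h g \<and> deriv g 0 = 0}"

definition dilatation :: "(complex \<Rightarrow> complex) \<Rightarrow> (complex \<Rightarrow> complex) \<Rightarrow> complex \<Rightarrow> complex" where
  "dilatation h g z = deriv g z / deriv h z"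

definition pre_Schwarzian :: "(complex \<Rightarrow> complex) \<Rightarrow> (complex \<Rightarrow> complex) \<Rightarrow> complex \<Rightarrow> complex" where
  "pre_Schwarzian h g z = deriv (deriv h) z / deriv h z -
     deriv (dilatation h g) z * cnj (dilatation h g z) / of_real (1 - (cmod (dilatation h g z))\<^sup>2)"

subsection \<open>Quasiconformal mappings\<close>

definition d_z :: "(complex \<Rightarrow> complex) \<Rightarrow> complex \<Rightarrow> complex" where
  "d_z f z = (pderiv_along 1 f z - \<i> * pderiv_along \<i> f z) / 2"

definition d_zbar :: "(complex \<Rightarrow> complex) \<Rightarrow> complex \<Rightarrow> complex" where
  "d_zbar f z = (pderiv_along 1 f z + \<i> * pderiv_along \<i> f z) / 2"

definition norm_D :: "(complex \<Rightarrow> complex) \<Rightarrow> complex \<Rightarrow> real" where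
  "norm_D f z = cmod (d_z f z) + cmod (d_zbar f z)"

definition det_D :: "(complex \<Rightarrow> complex) \<Rightarrow> complex \<Rightarrow> real" where
  "det_D f z = (cmod (d_z f z))\<^sup>2 - (cmod (d_zbar f z))\<^sup>2"

definition test_function :: "complex set \<Rightarrow> (complex \<Rightarrow> real) \<Rightarrow> bool" where
  "test_function S \<phi> \<longleftrightarrow> (\<forall>k. Ck_on k UNIV \<phi>) \<and>
     (\<exists>C. compact C \<and> C \<subseteq> S \<and> (\<forall>z. z \<notin> C \<longrightarrow> \<phi> z = 0))"

definition L2_loc :: "complex set \<Rightarrow> (complex \<Rightarrow> complex) \<Rightarrow> bool" where
  "L2_loc S f \<longleftrightarrow> f \<in> borel_measurable (lebesgue_on S) \<and>
     (\<forall>C. compact C \<and> C \<subseteq> S \<longrightarrow> integrable (lebesgue_on C) (\<lambda>z. (cmod (f z))\<^sup>2))"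

definition weak_pderiv :: "complex \<Rightarrow> complex set \<Rightarrow> (complex \<Rightarrow> complex) \<Rightarrow> (complex \<Rightarrow> complex) \<Rightarrow> bool" where
  "weak_pderiv v S f p \<longleftrightarrow> (\<forall>\<phi>. test_function S \<phi> \<longrightarrow>
     (LINT z|lebesgue_on S. pderiv_along v \<phi> z *\<^sub>R f z) = - (LINT z|lebesgue_on S. \<phi> z *\<^sub>R p z))"

definition W12_loc :: "complex set \<Rightarrow> (complex \<Rightarrow> complex) \<Rightarrow> bool" where
  "W12_loc S f \<longleftrightarrow> L2_loc S f \<and>
     (\<exists>p q. L2_loc S p \<and> L2_loc S q \<and> weak_pderiv 1 S f p \<and> weak_pderiv \<i> S f q)"

text \<open>
  The dilatation inequality is required at every point with the classical partial derivatives,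
  which is the right reading for the smooth mappings considered here.
\<close>

definition quasiconformal ::
    "real \<Rightarrow> (complex \<Rightarrow> complex) \<Rightarrow> complex set \<Rightarrow> complex set \<Rightarrow> bool" where
  "quasiconformal K f S T \<longleftrightarrow> K \<ge> 1 \<and>
     open S \<and> connected S \<and> open T \<and> connected T \<and>
     (\<exists>f'. homeomorphism S T f f') \<and> sense_preserving_on S f \<and> W12_loc S f \<and>
     (\<forall>z\<in>S. (norm_D f z)\<^sup>2 \<le> K * det_D f z)"

subsection \<open>Length and radial John disks\<close>

text \<open>The length of \<open>\<gamma>\<close> over \<open>{a..b}\<close> is the supremum of the lengths of inscribed polygons.\<close>

definition curve_length :: "(real \<Rightarrow> complex) \<Rightarrow> real \<Rightarrow> real \<Rightarrow> ennreal" where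
  "curve_length \<gamma> a b = (SUP ts \<in> {ts. sorted ts \<and> set ts \<subseteq> {a..b}}.
     ennreal (\<Sum>i<length ts - 1. dist (\<gamma> (ts ! i)) (\<gamma> (ts ! Suc i))))"

text \<open>The curve \<open>f([0,z])\<close>, parametrized over \<open>{0..1}\<close>.\<close>

definition radial_curve :: "(complex \<Rightarrow> complex) \<Rightarrow> complex \<Rightarrow> real \<Rightarrow> complex" where
  "radial_curve f z t = f (of_real t * z)"

text \<open>
  Since \<open>f\<close> is injective, the points of \<open>f([0,z\<^sub>1])\<close> are the \<open>w = radial_curve f z\<^sub>1 t\<close> with
  \<open>t \<in> {0..1}\<close>, and the subarc between \<open>w\<^sub>1 = f z\<^sub>1\<close> and \<open>w\<close> is the part over \<open>{t..1}\<close>.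
  The distance from \<open>w\<close> to the boundary is \<^term>\<open>infdist w (frontier G)\<close>.
\<close>

definition radial_c_John_disk :: "real \<Rightarrow> (complex \<Rightarrow> complex) \<Rightarrow> bool" where
  "radial_c_John_disk c f \<longleftrightarrow> c \<ge> 1 \<and>
     continuous_on (ball 0 1) f \<and> inj_on f (ball 0 1) \<and>
     bounded (f ` ball 0 1) \<and> simply_connected (f ` ball 0 1) \<and>
     (\<forall>z\<^sub>1\<in>ball 0 1. curve_length (radial_curve f z\<^sub>1) 0 1 < \<infinity> \<and>
       (\<forall>t\<in>{0..1}. curve_length (radial_curve f z\<^sub>1) t 1 \<le>
          ennreal (c * infdist (radial_curve f z\<^sub>1 t) (frontier (f ` ball 0 1)))))"

definition radial_John_disk :: "(complex \<Rightarrow> complex) \<Rightarrow> bool" where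
  "radial_John_disk f \<longleftrightarrow> (\<exists>c. radial_c_John_disk c f)"

end

theory Submission
  imports Defs
begin

text \<open>
  Write \<open>J = |h'|\<^sup>2 - |g'|\<^sup>2\<close> for the Jacobian of \<open>f = h + cnj g\<close>. Since \<open>P\<^sub>f\<close> is the
  \<open>z\<close>-derivative of \<open>log J\<close>, the radial derivative of \<open>log J\<close> at \<open>z = \<rho> \<zeta>\<close>, \<open>|\<zeta>| = 1\<close>, is
  \<open>2 Re (z P\<^sub>f z) / \<rho>\<close>. The upper limit being below \<open>1\<close>, this is at most
  \<open>2 / (\<rho> (1 - \<rho>\<^sup>2))\<close> for \<open>\<rho>\<close> near \<open>1\<close>, which says exactly that \<open>J(\<rho> \<zeta>) (1 / \<rho>\<^sup>2 - 1)\<close> does not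
  increase along the ray (\<open>jacobian_ray_decay\<close>). Quasiconformality bounds the speed
  \<open>|h'| + |g'|\<close> of \<open>f\<close> along the ray by \<open>sqrt (K J)\<close>, so beyond the point \<open>s \<zeta>\<close> the speed is at
  most a constant multiple of \<open>|h'(s \<zeta>)| sqrt (1 - s\<^sup>2) \<rho> / sqrt (1 - \<rho>\<^sup>2)\<close> (\<open>ray_speed_bound\<close>).
  This has the primitive \<open>- sqrt (1 - \<rho>\<^sup>2)\<close>, and integration shows that the image of the
  rest of the ray has length at most a constant times \<open>(1 - s) |h'(s \<zeta>)|\<close>.

  It remains to compare \<open>(1 - |z|) |h' z|\<close> with the distance of \<open>f z\<close> from the boundary of the
  image: a Koebe theorem for quasiconformal harmonic maps, \<open>norm_deriv_le_dist_omitted\<close>. Let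
  \<open>f\<close> be such a map of the unit disk that omits \<open>0\<close>, and suppose that \<open>|f|\<close> reaches
  \<open>2\<^sup>N |f 0|\<close> on the disk of radius \<open>1/2\<close>. Every circle \<open>|z| = r\<close> with \<open>r > 1/2\<close> then has
  a point where \<open>|f| \<le> |f 0|\<close>, because the image of the disk it bounds contains \<open>f 0\<close> but
  not \<open>0\<close>, and a point where \<open>|f| \<ge> 2\<^sup>N |f 0|\<close>, because \<open>f\<close> is open. So the image of each
  circle crosses the annulus between these radii, and its length in the metric \<open>|dw| / |w|\<close> is
  at least \<open>N ln 2\<close>. By Cauchy and Schwarz and by quasiconformality, \<open>N\<^sup>2\<close> is at most a
  constant times \<open>K\<close> times the area of the annulus in this metric, since \<open>f\<close> is injective.
  This area is proportional to \<open>N\<close>. Hence \<open>N\<close> is bounded in terms of \<open>K\<close>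
  (\<open>dyadic_growth\<close>): \<open>|f|\<close> is at most a constant times \<open>|f 0|\<close> on the half disk, and Cauchy's
  inequality gives the same for \<open>|h' 0|\<close>.

  Near the centre compactness bounds the speed from above and the distance from the boundary
  from below. At a zero of \<open>h'\<close>
  the dilatation bound makes \<open>g'\<close> vanish as well, so \<open>J\<close> and its derivative are zero there and the
  monotonicity along rays survives.
\<close>

section \<open>The area formula for injective harmonic maps\<close>

lemma measurable_vector_pair:
  "(\<lambda>p. vector [fst p, snd p] :: real^2) \<in> lborel \<Otimes>\<^sub>M lborel \<rightarrow>\<^sub>M borel"
proof -
  have "linear (\<lambda>p::real\<times>real. vector [fst p, snd p] :: real^2)"
    by (auto simp: linear_iff vec_eq_iff forall_2)
  then have "(\<lambda>p::real\<times>real. vector [fst p, snd p] :: real^2) \<in> borel \<rightarrow>\<^sub>M borel"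
    by (intro borel_measurable_continuous_onI linear_continuous_on) (simp add: linear_conv_bounded_linear)
  then show ?thesis by (simp add: lborel_prod)
qed

text \<open>
  The change of variables formula is stated for \<^typ>\<open>real^2\<close>, whereas iterated integrals need
  a product of two lines. This lets one pass from the first to the second.
\<close>

lemma lborel_plane_eq_distr_vector:
  "(lborel :: (real^2) measure) =
     distr (lborel \<Otimes>\<^sub>M lborel) borel (\<lambda>p. vector [fst p, snd p])"
proof (rule lborel_eqI)
  note meas = measurable_vector_pair
  fix l u :: "real^2"
  assume le: "\<And>b. b \<in> Basis \<Longrightarrow> l \<bullet> b \<le> u \<bullet> b"
  have le12: "l$1 \<le> u$1" "l$2 \<le> u$2"
    using le[of "axis 1 1"] le[of "axis 2 1"] by (auto simp: inner_axis Basis_vec_def)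
  have pre: "(\<lambda>p. vector [fst p, snd p] :: real^2) -` box l u = {l$1<..<u$1} \<times> {l$2<..<u$2}"
    by (auto simp: mem_box_cart forall_2)
  have "emeasure (distr (lborel \<Otimes>\<^sub>M lborel) borel (\<lambda>p. vector [fst p, snd p])) (box l u)
      = emeasure (lborel \<Otimes>\<^sub>M lborel) ({l$1<..<u$1} \<times> {l$2<..<u$2})"
    using meas by (simp add: emeasure_distr pre space_pair_measure)
  also have "\<dots> = ennreal ((u$1 - l$1) * (u$2 - l$2))"
    using le12 by (simp add: lborel.emeasure_pair_measure_Times ennreal_mult)
  also have "(u$1 - l$1) * (u$2 - l$2) = (\<Prod>b\<in>Basis. (u - l) \<bullet> b)"
    by (simp add: Basis_vec_def axis_eq_axis inner_axis prod.UNION_disjoint UNIV_2)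
  finally show "emeasure (distr (lborel \<Otimes>\<^sub>M lborel) borel (\<lambda>p. vector [fst p, snd p])) (box l u)
      = ennreal (\<Prod>b\<in>Basis. (u - l) \<bullet> b)" .
qed simp

lemma measurable_jacobian:
  assumes "open S" "H holomorphic_on S" "G holomorphic_on S" "A \<in> sets borel" "A \<subseteq> S"
  shows "(\<lambda>z. ennreal ((cmod (deriv H z))\<^sup>2 - (cmod (deriv G z))\<^sup>2) * indicator A z)
           \<in> borel_measurable borel"
proof -
  let ?J = "\<lambda>z. (cmod (deriv H z))\<^sup>2 - (cmod (deriv G z))\<^sup>2"
  have "deriv H holomorphic_on S" "deriv G holomorphic_on S"
    using assms holomorphic_deriv by blast+
  then have "continuous_on S ?J"
    by (intro continuous_intros holomorphic_on_imp_continuous_on)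
  then have "(\<lambda>z. indicator S z *\<^sub>R ?J z) \<in> borel_measurable borel"
    using \<open>open S\<close> borel_measurable_continuous_on_indicator by (metis borel_open)
  then have "(\<lambda>z. ennreal (indicator S z *\<^sub>R ?J z) * indicator A z) \<in> borel_measurable borel"
    using assms(4) by measurable
  moreover have "(\<lambda>z. ennreal (indicator S z *\<^sub>R ?J z) * indicator A z) = (\<lambda>z. ennreal (?J z) * indicator A z)"
    using assms(5) by (auto simp: fun_eq_iff indicator_def)
  ultimately show ?thesis by simp
qed

text \<open>
  The derivative \<open>w \<mapsto> H' w + cnj (G' w)\<close> of \<open>H + cnj G\<close> has determinant \<open>|H'|\<^sup>2 - |G'|\<^sup>2\<close>, so
  the integral is the area of the image of \<open>A\<close>, which lies in a square of side \<open>2 R\<close>.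
  The square is good enough in place of the disk, because only the quadratic dependence on \<open>R\<close>
  matters.
\<close>

lemma integral_jacobian_le_square:
  fixes H G :: "complex \<Rightarrow> complex" and A :: "complex set"
  assumes "open S" "H holomorphic_on S" "G holomorphic_on S"
    and A: "A \<in> sets borel" "A \<subseteq> S"
    and inj: "inj_on (\<lambda>z. H z + cnj (G z)) A"
    and img: "\<And>z. z \<in> A \<Longrightarrow> cmod (H z + cnj (G z)) \<le> R"
    and sense: "\<And>z. z \<in> A \<Longrightarrow> cmod (deriv G z) \<le> cmod (deriv H z)"
  shows "(\<integral>\<^sup>+x. \<integral>\<^sup>+y. ennreal ((cmod (deriv H (Complex x y)))\<^sup>2 - (cmod (deriv G (Complex x y)))\<^sup>2)
            * indicator A (Complex x y) \<partial>lborel \<partial>lborel) \<le> ennreal (4 * R\<^sup>2)"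
proof (cases "A = {}")
  case True then show ?thesis by simp
next
  case False
  then have R: "R \<ge> 0" using img norm_ge_zero order_trans by (metis ex_in_conv)
  define e :: "real^2 \<Rightarrow> complex" where "e v = Complex (v$1) (v$2)" for v
  define e' :: "complex \<Rightarrow> real^2" where "e' z = vector [Re z, Im z]" for z
  define F where "F z = H z + cnj (G z)" for z
  define \<Phi> where "\<Phi> v = e' (F (e v))" for v
  define B where "B = e -` A"
  have cont_e: "continuous_on UNIV e"
    unfolding e_def Complex_eq by (intro continuous_intros)
  have "e \<in> borel \<rightarrow>\<^sub>M borel" using cont_e by (rule borel_measurable_continuous_onI)
  then have Bb: "B \<in> sets borel" unfolding B_def using A(1)
    by (metis UNIV_I inf_top.right_neutral measurable_sets space_borel)
  then have Bl: "B \<in> sets lebesgue" by simp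
  define \<Phi>' where "\<Phi>' v w = e' (deriv H (e v) * e w + cnj (deriv G (e v) * e w))" for v w
  have lin_e: "bounded_linear e"
    unfolding linear_conv_bounded_linear[symmetric] e_def
    by (auto simp: linear_iff complex_eq_iff)
  have lin_e': "bounded_linear e'"
    unfolding linear_conv_bounded_linear[symmetric] e'_def
    by (auto simp: linear_iff vec_eq_iff forall_2)
  have derF: "(F has_derivative (\<lambda>w. deriv H z * w + cnj (deriv G z * w))) (at z)" if "z \<in> S" for z
  proof -
    have "(H has_field_derivative deriv H z) (at z)" "(G has_field_derivative deriv G z) (at z)"
      using assms that holomorphic_derivI by blast+
    then have 1: "(H has_derivative (*) (deriv H z)) (at z)" and "(G has_derivative (*) (deriv G z)) (at z)"
      by (auto simp: has_field_derivative_def)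
    from this(2) have "((\<lambda>z. cnj (G z)) has_derivative (\<lambda>w. cnj (deriv G z * w))) (at z)"
      by (rule has_derivative_cnj)
    from has_derivative_add[OF 1 this] show ?thesis unfolding F_def .
  qed
  have der: "(\<Phi> has_derivative \<Phi>' v) (at v within B)" if "v \<in> B" for v
  proof -
    have "e v \<in> S" using that A by (auto simp: B_def)
    have "((\<lambda>v. F (e v)) has_derivative (\<lambda>w. deriv H (e v) * e w + cnj (deriv G (e v) * e w))) (at v)"
      using has_derivative_compose[OF bounded_linear.has_derivative[OF lin_e has_derivative_ident] derF[OF \<open>e v \<in> S\<close>]]
      by (simp)
    from bounded_linear.has_derivative[OF lin_e' this]
    show ?thesis unfolding \<Phi>_def \<Phi>'_def by (rule has_derivative_at_withinI)
  qed
  have det: "det (matrix (\<Phi>' v)) = (cmod (deriv H (e v)))\<^sup>2 - (cmod (deriv G (e v)))\<^sup>2" for v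
    unfolding det_2 matrix_def \<Phi>'_def e'_def e_def axis_def cmod_power2
    by (simp add: algebra_simps power2_eq_square)
  have injB: "inj_on \<Phi> B"
  proof (rule inj_onI)
    fix v w assume vw: "v \<in> B" "w \<in> B" "\<Phi> v = \<Phi> w"
    then have "F (e v) = F (e w)"
      unfolding \<Phi>_def e'_def by (metis complex_eqI vector_2)
    then have "e v = e w" using inj vw unfolding F_def B_def inj_on_def by auto
    then show "v = w" by (auto simp: e_def vec_eq_iff forall_2)
  qed
  have sub: "\<Phi> ` B \<subseteq> cbox (vec (-R)) (vec R)"
  proof -
    have "\<bar>Re (F (e v))\<bar> \<le> R" "\<bar>Im (F (e v))\<bar> \<le> R" if "v \<in> B" for v
      using img[of "e v"] abs_Re_le_cmod[of "F (e v)"] abs_Im_le_cmod[of "F (e v)"] that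
      unfolding F_def B_def by auto
    then show ?thesis
      by (fastforce simp: mem_box_cart forall_2 \<Phi>_def e'_def abs_le_iff)
  qed
  have "\<Phi> ` B \<in> sets lebesgue"
    by (rule differentiable_image_in_sets_lebesgue[OF Bl])
       (use der in \<open>auto simp: differentiable_on_def differentiable_def\<close>)
  then have lm: "\<Phi> ` B \<in> lmeasurable"
    using sub bounded_cbox bounded_subset bounded_set_imp_lmeasurable by blast
  have "measure lebesgue (\<Phi> ` B) \<le> measure lebesgue (cbox (vec (-R)) (vec R :: real^2))"
    by (rule measure_mono_fmeasurable[OF sub]) (use \<open>\<Phi> ` B \<in> sets lebesgue\<close> in auto)
  also have "\<dots> = 4 * R\<^sup>2"
    using R by (simp add: content_cbox_cart interval_eq_empty_cart prod_constant power2_eq_square)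
  finally have m: "measure lebesgue (\<Phi> ` B) \<le> 4 * R\<^sup>2" .
  have "((\<lambda>v. \<bar>det (matrix (\<Phi>' v))\<bar>) has_integral measure lebesgue (\<Phi> ` B)) B"
    using has_measure_differentiable_image[OF Bl der injB] lm by blast
  then have "(\<integral>\<^sup>+v. ennreal \<bar>det (matrix (\<Phi>' v))\<bar> * indicator B v \<partial>lborel) = ennreal (measure lebesgue (\<Phi> ` B))"
    by (intro nn_integral_has_integral_lebesgue') auto
  moreover have "ennreal \<bar>det (matrix (\<Phi>' v))\<bar> * indicator B v =
      ennreal ((cmod (deriv H (e v)))\<^sup>2 - (cmod (deriv G (e v)))\<^sup>2) * indicator A (e v)" for v
    using power_mono[OF sense[of "e v"], of 2] unfolding det by (auto simp: B_def indicator_def)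
  ultimately have le: "(\<integral>\<^sup>+v. ennreal ((cmod (deriv H (e v)))\<^sup>2 - (cmod (deriv G (e v)))\<^sup>2) * indicator A (e v) \<partial>lborel)
      \<le> ennreal (4 * R\<^sup>2)"
    using m by (simp add: ennreal_leI)
  define q where "q z = ennreal ((cmod (deriv H z))\<^sup>2 - (cmod (deriv G z))\<^sup>2) * indicator A z" for z
  have qm: "q \<in> borel_measurable borel"
    unfolding q_def using measurable_jacobian[OF assms(1-3) A] .
  note vm = measurable_vector_pair
  have qe: "(\<lambda>v. q (e v)) \<in> borel_measurable borel"
    using qm \<open>e \<in> borel \<rightarrow>\<^sub>M borel\<close> by measurable
  have "(\<integral>\<^sup>+x. \<integral>\<^sup>+y. q (Complex x y) \<partial>lborel \<partial>lborel)
      = (\<integral>\<^sup>+x. \<integral>\<^sup>+y. q (e (vector [fst (x,y), snd (x,y)])) \<partial>lborel \<partial>lborel)"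
    by (simp add: e_def)
  also have "\<dots> = (\<integral>\<^sup>+p. q (e (vector [fst p, snd p])) \<partial>(lborel \<Otimes>\<^sub>M lborel))"
    by (rule lborel.nn_integral_fst) (use measurable_compose[OF vm qe] in simp)
  also have "\<dots> = (\<integral>\<^sup>+v. q (e v) \<partial>lborel)"
    by (subst lborel_plane_eq_distr_vector, subst nn_integral_distr[OF vm]) (use qe in simp_all)
  finally show ?thesis using le unfolding q_def by simp
qed

section \<open>Energy of a curve that crosses an annulus\<close>

text \<open>
  Take \<open>\<alpha>\<close> to be the last time in \<open>{s..t}\<close> with \<open>c \<le> a\<close>, and \<open>\<beta>\<close> the first time after \<open>\<alpha>\<close>
  with \<open>c \<ge> b\<close>.
\<close>

lemma exists_upcrossing:
  fixes c :: "real \<Rightarrow> real"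
  assumes "continuous_on {s..t} c" "s \<le> t" "c s \<le> a" "b \<le> c t" "a < b"
  obtains \<alpha> \<beta> where "s \<le> \<alpha>" "\<alpha> < \<beta>" "\<beta> \<le> t" "c \<alpha> = a" "c \<beta> = b"
    "\<And>y. y \<in> {\<alpha>..\<beta>} \<Longrightarrow> a \<le> c y \<and> c y \<le> b"
proof -
  have "compact {y \<in> {s..t}. c y \<le> a}" 
    using continuous_closed_preimage[OF assms(1), of "{..a}"]
    by (auto simp: vimage_def Int_def compact_eq_bounded_closed intro: bounded_subset[OF bounded_closed_interval[of s t]])
  then obtain \<alpha> where \<alpha>: "\<alpha> \<in> {s..t}" "c \<alpha> \<le> a" and \<alpha>max: "\<And>y. y \<in> {s..t} \<Longrightarrow> c y \<le> a \<Longrightarrow> y \<le> \<alpha>"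
    using assms compact_attains_sup[of "{y \<in> {s..t}. c y \<le> a}"] by force
  have cont\<alpha>: "continuous_on {\<alpha>..t} c" using assms(1) \<alpha> by (auto elim: continuous_on_subset)
  have "compact {y \<in> {\<alpha>..t}. b \<le> c y}" 
    using continuous_closed_preimage[OF cont\<alpha>, of "{b..}"]
    by (auto simp: vimage_def Int_def compact_eq_bounded_closed intro: bounded_subset[OF bounded_closed_interval[of \<alpha> t]])
  then obtain \<beta> where \<beta>: "\<beta> \<in> {\<alpha>..t}" "b \<le> c \<beta>" and \<beta>min: "\<And>y. y \<in> {\<alpha>..t} \<Longrightarrow> b \<le> c y \<Longrightarrow> \<beta> \<le> y"
    using assms \<alpha> compact_attains_inf[of "{y \<in> {\<alpha>..t}. b \<le> c y}"] by force
  have cont: "continuous_on {\<alpha>..\<beta>} c" using assms(1) \<alpha> \<beta> by (auto elim: continuous_on_subset)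
  obtain y where "\<alpha> \<le> y" "y \<le> \<beta>" "c y = a"
    using IVT'[of c \<alpha> a \<beta>] \<alpha> \<beta> \<open>a < b\<close> cont by auto
  with \<alpha>max[of y] \<alpha> \<beta> have ca: "c \<alpha> = a" by auto
  obtain y where "\<alpha> \<le> y" "y \<le> \<beta>" "c y = b"
    using IVT'[of c \<alpha> b \<beta>] \<alpha> \<beta> \<open>a < b\<close> cont by auto
  with \<beta>min[of y] \<alpha> \<beta> have cb: "c \<beta> = b" by auto
  show thesis
  proof
    show "s \<le> \<alpha>" "\<beta> \<le> t" using \<alpha> \<beta> by auto
    show "\<alpha> < \<beta>" using \<beta> ca cb \<open>a < b\<close> by (cases "\<alpha> = \<beta>") auto
    fix y assume y: "y \<in> {\<alpha>..\<beta>}"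
    show "a \<le> c y \<and> c y \<le> b"
      using \<alpha>max[of y] \<beta>min[of y] y \<alpha> \<beta> ca cb by (cases "y = \<alpha>"; cases "y = \<beta>") force+
  qed (use ca cb in auto)
qed

lemma exists_crossing:
  fixes c :: "real \<Rightarrow> real"
  assumes cont: "continuous_on {s..t} c" and t: "t1 \<in> {s..t}" "t2 \<in> {s..t}"
    and c: "c t1 \<le> a" "b \<le> c t2" "a < b"
  obtains \<alpha> \<beta> where "s \<le> \<alpha>" "\<alpha> < \<beta>" "\<beta> \<le> t" "{c \<alpha>, c \<beta>} = {a, b}"
    "\<And>y. y \<in> {\<alpha>..\<beta>} \<Longrightarrow> a \<le> c y \<and> c y \<le> b"
proof (cases "t1 \<le> t2")
  case True
  have "continuous_on {t1..t2} c" using cont t by (auto elim: continuous_on_subset)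
  from exists_upcrossing[OF this True c] t that show thesis by (smt (verit) atLeastAtMost_iff)
next
  case False
  have "continuous_on {-t1..-t2} (\<lambda>y. c (-y))"
    by (rule continuous_on_compose2[OF cont]) (use t in \<open>auto intro: continuous_intros\<close>)
  then obtain \<alpha> \<beta> where *: "-t1 \<le> \<alpha>" "\<alpha> < \<beta>" "\<beta> \<le> -t2" "c (-\<alpha>) = a" "c (-\<beta>) = b"
    "\<And>y. y \<in> {\<alpha>..\<beta>} \<Longrightarrow> a \<le> c (-y) \<and> c (-y) \<le> b"
    using exists_upcrossing[of "-t1" "-t2" "\<lambda>y. c (-y)" a b] False c by auto
  show thesis
    by (rule that[of "-\<beta>" "-\<alpha>"]) (use * t *(6)[of "- y" for y] in auto)
qed

lemma has_vector_derivative_ln_norm: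
  fixes F :: "real \<Rightarrow> 'a::real_inner"
  assumes "(F has_vector_derivative F') (at y)" "F y \<noteq> 0"
  shows "((\<lambda>y. ln (norm (F y))) has_vector_derivative (inner (sgn (F y)) F' / norm (F y))) (at y)"
proof -
  have "((\<lambda>y. norm (F y)) has_derivative (\<lambda>h. inner (sgn (F y)) (h *\<^sub>R F'))) (at y)"
    using assms has_derivative_compose[OF assms(1)[unfolded has_vector_derivative_def] has_derivative_norm[OF assms(2)]]
    by (simp add: inner_commute)
  then have "((\<lambda>y. norm (F y)) has_real_derivative inner (sgn (F y)) F') (at y)"
    by (simp add: has_field_derivative_def mult_commute_abs)
  from DERIV_chain'[OF this DERIV_ln_divide[of "norm (F y)"]] assms(2)
  show ?thesis by (simp add: has_real_derivative_iff_has_vector_derivative mult.commute)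
qed

text \<open>
  Along a piece of the curve that crosses the annulus, \<open>ln |F|\<close> changes by \<open>ln (b/a)\<close> and has
  derivative at most \<open>q = p / |F|\<close>. So \<open>ln (b/a)\<close> is at most the integral of \<open>q\<close> over this
  piece, and the claim is the Cauchy-Schwarz inequality. The open interval in the indicator is what
  makes \<open>exp\<close> injective when \<open>s = 0\<close> and \<open>t = 2 \<pi>\<close>.
\<close>

lemma log_crossing_energy:
  fixes F :: "real \<Rightarrow> complex" and p :: "real \<Rightarrow> real"
  assumes F: "\<And>y. y \<in> {s..t} \<Longrightarrow> (F has_vector_derivative F' y) (at y)"
    and p: "\<And>y. y \<in> {s..t} \<Longrightarrow> cmod (F' y) \<le> p y" "continuous_on {s..t} p"
    and ab: "0 < a" "a < b" and t: "u \<in> {s..t}" "v \<in> {s..t}" "cmod (F u) \<le> a" "b \<le> cmod (F v)"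
  shows "ennreal ((ln (b/a))\<^sup>2) \<le> ennreal (t - s) * (\<integral>\<^sup>+y. ennreal ((p y / cmod (F y))\<^sup>2)
            * indicator {y \<in> {s<..<t}. a \<le> cmod (F y) \<and> cmod (F y) \<le> b} y \<partial>lborel)"
proof -
  have contF: "continuous_on {s..t} F"
    using F has_vector_derivative_continuous continuous_at_imp_continuous_on by blast
  then have "continuous_on {s..t} (\<lambda>y. cmod (F y))" by (intro continuous_intros)
  from exists_crossing[OF this t(1,2) _ _ ab(2)] t obtain \<alpha> \<beta> where
    ab': "s \<le> \<alpha>" "\<alpha> < \<beta>" "\<beta> \<le> t" and ends: "{cmod (F \<alpha>), cmod (F \<beta>)} = {a, b}"
    and bet: "\<And>y. y \<in> {\<alpha>..\<beta>} \<Longrightarrow> a \<le> cmod (F y) \<and> cmod (F y) \<le> b" by blast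
  have nz: "F y \<noteq> 0" if "y \<in> {\<alpha>..\<beta>}" for y using bet[OF that] ab by auto
  define q where "q y = p y / cmod (F y)" for y
  have contq: "continuous_on {\<alpha>..\<beta>} q"
    unfolding q_def using nz ab'
    by (intro continuous_intros continuous_on_subset[OF p(2)] continuous_on_subset[OF contF]) auto
  define I where "I = integral {\<alpha>..\<beta>} (\<lambda>y. (q y)\<^sup>2)"
  have contq2: "continuous_on {\<alpha>..\<beta>} (\<lambda>y. (q y)\<^sup>2)" by (intro continuous_intros contq)
  define L where "L = ln (b/a)"
  have L: "L > 0" using ab by (simp add: L_def)
  \<comment> \<open>Cauchy-Schwarz in the form \<open>q \<le> \<tau> q\<^sup>2 / 2 + 1 / (2 \<tau>)\<close>, integrated over the crossing;
    the choice of \<open>\<tau>\<close> below is the optimal one up to a constant.\<close>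
  have key: "L \<le> \<tau> / 2 * I + (\<beta> - \<alpha>) / (2 * \<tau>)" if "\<tau> > 0" for \<tau>
  proof -
    define \<phi> where "\<phi> y = \<tau> / 2 * integral {\<alpha>..y} (\<lambda>y. (q y)\<^sup>2) + y / (2 * \<tau>)" for y
    have "norm (ln (cmod (F \<beta>)) - ln (cmod (F \<alpha>))) \<le> \<phi> \<beta> - \<phi> \<alpha>"
    proof (rule differentiable_bound_general[OF \<open>\<alpha> < \<beta>\<close>])
      show "continuous_on {\<alpha>..\<beta>} (\<lambda>y. ln (cmod (F y)))"
        using nz ab' by (intro continuous_intros continuous_on_subset[OF contF]) auto
      show "continuous_on {\<alpha>..\<beta>} \<phi>" unfolding \<phi>_def
        by (intro continuous_intros indefinite_integral_continuous_1 integrable_continuous_interval contq2) (use that in auto)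
      fix x assume x: "\<alpha> < x" "x < \<beta>"
      show "((\<lambda>y. ln (cmod (F y))) has_vector_derivative inner (sgn (F x)) (F' x) / cmod (F x)) (at x)"
        using has_vector_derivative_ln_norm[OF F[of x] nz[of x]] x ab' by auto
      have "((\<lambda>y. integral {\<alpha>..y} (\<lambda>y. (q y)\<^sup>2)) has_vector_derivative (q x)\<^sup>2) (at x within {\<alpha>..\<beta>})"
        using integral_has_vector_derivative[OF contq2] x by auto
      then have "((\<lambda>y. integral {\<alpha>..y} (\<lambda>y. (q y)\<^sup>2)) has_real_derivative (q x)\<^sup>2) (at x)"
        using x by (simp add: at_within_Icc_at has_real_derivative_iff_has_vector_derivative)
      then have "(\<phi> has_real_derivative (\<tau> / 2 * (q x)\<^sup>2 + 1 / (2 * \<tau>))) (at x)"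
        unfolding \<phi>_def using that by (auto intro!: derivative_eq_intros)
      then show "(\<phi> has_vector_derivative (\<tau> / 2 * (q x)\<^sup>2 + 1 / (2 * \<tau>))) (at x)"
        by (simp add: has_real_derivative_iff_has_vector_derivative)
      have "norm (inner (sgn (F x)) (F' x) / cmod (F x)) \<le> cmod (F' x) / cmod (F x)"
        using Cauchy_Schwarz_ineq2[of "sgn (F x)" "F' x"] nz[of x] x
        by (auto simp: norm_sgn intro!: divide_right_mono)
      also have "\<dots> \<le> q x" unfolding q_def using p(1)[of x] x ab' by (intro divide_right_mono) auto
      also have "q x \<le> \<tau> / 2 * (q x)\<^sup>2 + 1 / (2 * \<tau>)"
      proof -
        have "0 \<le> (\<tau> * q x - 1)\<^sup>2 / (2 * \<tau>)" using that by auto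
        also have "\<dots> = \<tau> / 2 * (q x)\<^sup>2 + 1 / (2 * \<tau>) - q x" using that
          by (simp add: field_simps power2_eq_square)
        finally show ?thesis by simp
      qed
      finally show "norm (inner (sgn (F x)) (F' x) / cmod (F x)) \<le> \<tau> / 2 * (q x)\<^sup>2 + 1 / (2 * \<tau>)" .
    qed
    also have "\<phi> \<beta> - \<phi> \<alpha> = \<tau> / 2 * I + (\<beta> - \<alpha>) / (2 * \<tau>)"
      unfolding \<phi>_def I_def using that by (simp add: field_simps)
    finally show ?thesis using ends ab L_def by (auto simp: doubleton_eq_iff ln_div)
  qed
  have ts: "t - s > 0" using ab' by auto
  have "L \<le> (t - s) / L / 2 * I + (\<beta> - \<alpha>) / (2 * ((t - s) / L))" using key[of "(t - s) / L"] ts L by simp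
  also have "(\<beta> - \<alpha>) / (2 * ((t - s) / L)) \<le> (t - s) / (2 * ((t - s) / L))"
    using ab' ts L by (intro divide_right_mono) auto
  also have "\<dots> = L / 2" using ts by (simp add: field_simps)
  finally have "L / 2 \<le> (t - s) / L / 2 * I" by linarith
  then have "2 * L * (L / 2) \<le> 2 * L * ((t - s) / L / 2 * I)"
    using L by (intro mult_left_mono) auto
  then have L2: "L\<^sup>2 \<le> (t - s) * I" using L by (simp add: power2_eq_square)
  have "((\<lambda>y. (q y)\<^sup>2) has_integral I) {\<alpha>..\<beta>}"
    unfolding I_def by (intro integrable_integral integrable_continuous_interval contq2)
  then have "((\<lambda>y. (q y)\<^sup>2) has_integral I) {\<alpha><..<\<beta>}" by (simp add: has_integral_Icc_iff_Ioo)
  then have "(\<integral>\<^sup>+y. ennreal ((q y)\<^sup>2) * indicator {\<alpha><..<\<beta>} y \<partial>lborel) = ennreal I"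
    by (intro nn_integral_has_integral_lebesgue') auto
  then have "ennreal I \<le> (\<integral>\<^sup>+y. ennreal ((q y)\<^sup>2)
            * indicator {y \<in> {s<..<t}. a \<le> cmod (F y) \<and> cmod (F y) \<le> b} y \<partial>lborel)"
    using ab' bet by (auto simp: indicator_def intro!: nn_integral_mono elim!: ord_eq_le_trans[OF sym])
  then show ?thesis using L2 ts unfolding L_def q_def
    by (smt (verit) I_def ennreal_leI ennreal_mult' mult_left_mono order_trans zero_le)
qed

section \<open>Growth of quasiconformal harmonic maps that omit a value\<close>

text \<open>
  The segment from \<open>F 0\<close> to the omitted value \<open>0\<close> must leave the image of the ball, hence it meets
  the image of the sphere, and no point of the segment is farther from \<open>0\<close> than \<open>F 0\<close>.
\<close>

lemma image_sphere_near:
  fixes F :: "complex \<Rightarrow> complex"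
  assumes "continuous_on (cball 0 r) F" "inj_on F (ball 0 r)" "0 < r" "0 \<notin> F ` cball 0 r"
  obtains z where "cmod z = r" "cmod (F z) \<le> cmod (F 0)"
proof -
  have op: "open (F ` ball 0 r)"
    using assms by (intro invariance_of_domain) (auto elim: continuous_on_subset)
  have "compact (F ` cball 0 r)" using assms by (intro compact_continuous_image) auto
  then have "closure (F ` ball 0 r) \<subseteq> F ` cball 0 r"
    by (intro closure_minimal compact_imp_closed) auto
  then have fr: "frontier (F ` ball 0 r) \<subseteq> F ` sphere 0 r"
    using op unfolding frontier_def by (fastforce simp: interior_open)
  have "connected (closed_segment 0 (F 0))" by simp
  moreover have "closed_segment 0 (F 0) \<inter> F ` ball 0 r \<noteq> {}" using \<open>0 < r\<close> by force
  moreover have "0 \<in> closed_segment 0 (F 0) - F ` ball 0 r"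
    using assms(4) by (auto simp del: mem_ball simp: ball_def)
  ultimately obtain w where w: "w \<in> closed_segment 0 (F 0)" "w \<in> frontier (F ` ball 0 r)"
    using connected_Int_frontier[of "closed_segment 0 (F 0)" "F ` ball 0 r"] by blast
  then obtain z where "z \<in> sphere 0 r" "w = F z" using fr by blast
  then show thesis using that[of z] segment_bound1[OF w(1)] by simp
qed

text \<open>
  The image of the open ball is open by invariance of domain, so it contains no point of largest
  modulus.
\<close>

lemma image_sphere_far:
  fixes F :: "complex \<Rightarrow> complex"
  assumes "continuous_on (cball 0 r) F" "inj_on F (ball 0 r)" "0 \<notin> F ` cball 0 r" "z0 \<in> cball 0 r"
  obtains z where "cmod z = r" "cmod (F z0) \<le> cmod (F z)"
proof -
  have "continuous_on (cball 0 r) (\<lambda>z. cmod (F z))" using assms by (intro continuous_intros)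
  moreover have "cball (0::complex) r \<noteq> {}" using assms(4) by blast
  ultimately have "\<exists>z\<in>cball 0 r. \<forall>y\<in>cball 0 r. cmod (F y) \<le> cmod (F z)"
    by (intro continuous_attains_sup) simp_all
  then obtain z where z: "z \<in> cball 0 r" and max: "\<And>y. y \<in> cball 0 r \<Longrightarrow> cmod (F y) \<le> cmod (F z)"
    by metis
  have "z \<notin> ball 0 r"
  proof
    assume zb: "z \<in> ball 0 r"
    have "open (F ` ball 0 r)"
      using assms by (intro invariance_of_domain) (auto elim: continuous_on_subset)
    then obtain e where e: "e > 0" "ball (F z) e \<subseteq> F ` ball 0 r"
      using zb open_contains_ball by blast
    have nz: "F z \<noteq> 0" using assms z by force
    define w where "w = F z + of_real (e / 2) * sgn (F z)"
    have "w \<in> ball (F z) e" using e nz by (simp add: w_def dist_norm norm_mult norm_sgn)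
    then obtain y where y: "y \<in> ball 0 r" "F y = w" using e by auto
    have "w = of_real (cmod (F z) + e / 2) * sgn (F z)"
      unfolding w_def of_real_add distrib_right using nz
      by (simp add: sgn_eq)
    then have "cmod w = cmod (F z) + e / 2" using e nz by (simp add: norm_mult norm_sgn del: of_real_add)
    then show False using max[of y] y e by auto
  qed
  then have "cmod z = r" using z by simp
  then show thesis using that[of z] max[OF assms(4)] by blast
qed

text \<open>
  The length-area argument. In the coordinates \<open>x + \<i> y = log z\<close> the circles become the segments
  \<open>x = const\<close>, \<open>0 < y < 2 \<pi>\<close>, and \<open>F = f \<circ> exp\<close> is again harmonic with the same dilatation bound.
  Each segment gives \<open>(N ln 2)\<^sup>2 \<le> 2 \<pi> \<integral> (|H'| + |G'|)\<^sup>2 / |F|\<^sup>2\<close>, integrated over the part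
  that \<open>F\<close> maps into the annulus \<open>d \<le> |w| \<le> 2\<^sup>N d\<close>. This annulus is split into \<open>N\<close> dyadic ones,
  on which \<open>|F|\<close> varies by a factor of at most \<open>2\<close>; the part of the strip mapped into the \<open>k\<close>-th one, \<open>A k\<close>,
  contributes at most \<open>K / (2\<^sup>k d)\<^sup>2 * 4 (2\<^sup>k\<^sup>+\<^sup>1 d)\<^sup>2 = 16 K\<close>. Integrating
  over \<open>x\<close> therefore bounds \<open>N\<^sup>2\<close> by a multiple of \<open>N\<close>.
\<close>

lemma dyadic_growth:
  fixes h g :: "complex \<Rightarrow> complex"
  defines "f \<equiv> \<lambda>z. h z + cnj (g z)"
  assumes h: "h holomorphic_on ball 0 1" and g: "g holomorphic_on ball 0 1"
    and inj: "inj_on f (ball 0 1)" and omit: "0 \<notin> f ` ball 0 1"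
    and qc: "\<And>z. z \<in> ball 0 1 \<Longrightarrow>
       (cmod (deriv h z) + cmod (deriv g z))\<^sup>2 \<le> K * ((cmod (deriv h z))\<^sup>2 - (cmod (deriv g z))\<^sup>2)"
    and K: "K \<ge> 1" and z0: "cmod z0 \<le> 1 / 2" and N: "2 ^ N * cmod (f 0) \<le> cmod (f z0)"
  shows "real N * (ln 2)\<^sup>2 \<le> 64 * pi * K"
proof (cases "N = 0")
  case True
  then show ?thesis using K by simp
next
  case False
  define d where "d = cmod (f 0)"
  have d: "d > 0" using omit by (force simp: d_def)
  define S where "S = {z. Re z < 0}"
  define H where "H = h \<circ> exp"
  define G where "G = g \<circ> exp"
  \<comment> \<open>The radii \<open>e\<^sup>x\<close> with \<open>x \<in> X\<close> lie between \<open>1/2\<close> and \<open>\<surd>e / 2 < 1\<close>: the circles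
    lie in the unit disk and enclose \<open>z0\<close>.\<close>
  define X where "X = {- ln 2 <..< - ln 2 + 1/2 :: real}"
  have "open S" by (simp add: S_def open_halfspace_Re_lt)
  have expS: "exp z \<in> ball 0 1" if "z \<in> S" for z using that by (simp add: S_def)
  have derH: "(H has_field_derivative deriv h (exp z) * exp z) (at z)"
    and derG: "(G has_field_derivative deriv g (exp z) * exp z) (at z)" if "z \<in> S" for z
    using DERIV_chain[OF holomorphic_derivI[OF h open_ball expS[OF that]] DERIV_exp]
      DERIV_chain[OF holomorphic_derivI[OF g open_ball expS[OF that]] DERIV_exp]
    by (auto simp: H_def G_def)
  have holH: "H holomorphic_on S" and holG: "G holomorphic_on S"
    unfolding holomorphic_on_open[OF \<open>open S\<close>] using derH derG by blast+
  define F where "F z = H z + cnj (G z)" for z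
  have F: "F z = f (exp z)" for z by (simp add: F_def H_def G_def f_def)
  have contF: "continuous_on S F" unfolding F_def
    by (intro continuous_intros holomorphic_on_imp_continuous_on holH holG)
  have qc': "(cmod (deriv H z) + cmod (deriv G z))\<^sup>2 \<le> K * ((cmod (deriv H z))\<^sup>2 - (cmod (deriv G z))\<^sup>2)"
    if "z \<in> S" for z
  proof -
    have "(cmod (exp z))\<^sup>2 * (cmod (deriv h (exp z)) + cmod (deriv g (exp z)))\<^sup>2
       \<le> (cmod (exp z))\<^sup>2 * (K * ((cmod (deriv h (exp z)))\<^sup>2 - (cmod (deriv g (exp z)))\<^sup>2))"
      using qc[OF expS[OF that]] by (rule mult_left_mono) simp
    then show ?thesis
      using DERIV_imp_deriv[OF derH[OF that]] DERIV_imp_deriv[OF derG[OF that]]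
      by (simp add: norm_mult power2_eq_square algebra_simps)
  qed
  have XS: "Complex x y \<in> S" if "x \<in> X" for x y
  proof -
    have "(1/2::real) < ln 2" using ln_2_less_1 ln2_ge_two_thirds by simp
    then show ?thesis using that by (simp add: X_def S_def)
  qed
  define U where "U = {z. Re z \<in> X \<and> Im z \<in> {0<..<2*pi}}"
  have "U = box (Complex (- ln 2) 0) (Complex (- ln 2 + 1/2) (2*pi))"
    by (auto simp: U_def X_def in_box_complex_iff)
  then have "open U" by (simp only: open_box)
  have US: "U \<subseteq> S"
  proof
    fix z assume "z \<in> U"
    then show "z \<in> S" using XS[of "Re z" "Im z"] by (simp add: U_def)
  qed
  define A where "A k = {z \<in> U. 2 ^ k * d \<le> cmod (F z) \<and> cmod (F z) \<le> 2 ^ Suc k * d}" for k :: nat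
  have AS: "A k \<subseteq> S" for k using US by (auto simp: A_def)
  have Ab: "A k \<in> sets borel" for k
  proof -
    have "continuous_on U (\<lambda>z. cmod (F z))"
      using contF US by (intro continuous_intros) (auto elim: continuous_on_subset)
    then have "closedin (top_of_set U) (U \<inter> (\<lambda>z. cmod (F z)) -` {2 ^ k * d..2 ^ Suc k * d})"
      by (rule continuous_closedin_preimage) simp
    then obtain T where "closed T" "U \<inter> (\<lambda>z. cmod (F z)) -` {2 ^ k * d..2 ^ Suc k * d} = U \<inter> T"
      using closedin_closed by blast
    moreover have "A k = U \<inter> (\<lambda>z. cmod (F z)) -` {2 ^ k * d..2 ^ Suc k * d}" by (auto simp: A_def)
    ultimately show ?thesis using \<open>open U\<close> by simp
  qed
  define J where "J k z = ennreal ((cmod (deriv H z))\<^sup>2 - (cmod (deriv G z))\<^sup>2) * indicator (A k) z" for k z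
  have Jm: "J k \<in> borel_measurable borel" for k
    unfolding J_def using measurable_jacobian[OF \<open>open S\<close> holH holG Ab AS] .
  have "(\<lambda>p. Complex (fst p) (snd p)) \<in> borel \<rightarrow>\<^sub>M borel"
    unfolding Complex_eq by (intro borel_measurable_continuous_onI continuous_intros)
  then have cm: "(\<lambda>p. Complex (fst p) (snd p)) \<in> lborel \<Otimes>\<^sub>M lborel \<rightarrow>\<^sub>M borel"
    by (simp add: lborel_prod)
  have "(\<lambda>p. J k (Complex (fst p) (snd p))) \<in> borel_measurable (lborel \<Otimes>\<^sub>M lborel)" for k
    using measurable_compose[OF cm Jm] .
  from lborel.borel_measurable_nn_integral_fst[OF this]
  have Jm1: "(\<lambda>x. \<integral>\<^sup>+y. J k (Complex x y) \<partial>lborel) \<in> borel_measurable lborel" for k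
    by simp
  have Jm2: "(\<lambda>y. J k (Complex x y)) \<in> borel_measurable lborel" for k x
    using measurable_compose[OF _ Jm, of "Complex x" lborel] unfolding Complex_eq by simp
  have area: "(\<integral>\<^sup>+x. \<integral>\<^sup>+y. J k (Complex x y) \<partial>lborel \<partial>lborel) \<le> ennreal (4 * (2 ^ Suc k * d)\<^sup>2)" for k
    unfolding J_def
  proof (rule integral_jacobian_le_square[OF \<open>open S\<close> holH holG Ab AS])
    show "inj_on (\<lambda>z. H z + cnj (G z)) (A k)"
    proof (rule inj_onI)
      fix z w assume zw: "z \<in> A k" "w \<in> A k" "H z + cnj (G z) = H w + cnj (G w)"
      then have "f (exp z) = f (exp w)" using F by (simp add: F_def)
      then have "exp z = exp w" using inj expS AS zw by (meson inj_onD subsetD)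
      moreover have "\<bar>Im z - Im w\<bar> < 2 * pi" using zw by (auto simp: A_def U_def)
      ultimately show "z = w" by (rule exp_complex_eqI[rotated])
    qed
    fix z assume z: "z \<in> A k"
    then show "cmod (H z + cnj (G z)) \<le> 2 ^ Suc k * d" by (simp add: A_def F_def)
    have "0 \<le> K * ((cmod (deriv H z))\<^sup>2 - (cmod (deriv G z))\<^sup>2)"
      using qc'[of z] AS z by (meson order_trans subsetD zero_le_power2)
    then show "cmod (deriv G z) \<le> cmod (deriv H z)"
      using K by (simp add: zero_le_mult_iff abs_le_square_iff[symmetric])
  qed
  \<comment> \<open>\<open>c k\<close> bounds the density \<open>K / |F|\<^sup>2\<close> on \<open>A k\<close>.\<close>
  define c where "c k = K / (2 ^ k * d)\<^sup>2" for k :: nat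
  have c0: "c k \<ge> 0" for k using K by (simp add: c_def)
  define L where "L = real N * ln 2"
  have slice: "ennreal (L\<^sup>2) * indicator X x
      \<le> ennreal (2 * pi) * (\<Sum>k<N. ennreal (c k) * (\<integral>\<^sup>+y. J k (Complex x y) \<partial>lborel))" for x
  proof (cases "x \<in> X")
    case x: True
    define r where "r = exp x"
    have r: "1/2 < r" "r < 1"
      using x XS[OF x, of 0] by (auto simp: r_def X_def S_def exp_less_cancel_iff[of "- ln 2", symmetric] exp_minus simp del: exp_less_cancel_iff)
    have cb: "cball 0 r \<subseteq> ball (0::complex) 1" using r by auto
    have contf: "continuous_on (cball 0 r) f" unfolding f_def
      by (intro continuous_intros holomorphic_on_imp_continuous_on holomorphic_on_subset[OF h cb] holomorphic_on_subset[OF g cb])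
    have injr: "inj_on f (ball 0 r)" using inj r by (auto elim: inj_on_subset)
    have omr: "0 \<notin> f ` cball 0 r" using omit cb by blast
    have polar: "\<exists>y\<in>{0..2*pi}. exp (Complex x y) = z" if "cmod z = r" for z
    proof (intro bexI)
      show "exp (Complex x (Arg2pi z)) = z"
        using that Arg2pi_eq[of z] r by (simp add: Complex_eq exp_add r_def exp_of_real mult.commute)
      show "Arg2pi z \<in> {0..2*pi}" using Arg2pi_ge_0[of z] Arg2pi_lt_2pi[of z] by auto
    qed
    obtain z1 where z1: "cmod z1 = r" "cmod (f z1) \<le> cmod (f 0)"
      using image_sphere_near[OF contf injr _ omr] r by auto
    obtain t1 where t1: "t1 \<in> {0..2*pi}" "exp (Complex x t1) = z1" using polar z1 by blast
    obtain z2 where z2: "cmod z2 = r" "cmod (f z0) \<le> cmod (f z2)"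
      using image_sphere_far[OF contf injr omr, of z0] r z0 by auto
    obtain t2 where t2: "t2 \<in> {0..2*pi}" "exp (Complex x t2) = z2" using polar z2 by blast
    define F1 where "F1 y = F (Complex x y)" for y
    define p where "p y = cmod (deriv H (Complex x y)) + cmod (deriv G (Complex x y))" for y
    have "ennreal ((ln ((2^N * d) / d))\<^sup>2) \<le> ennreal (2*pi - 0) * (\<integral>\<^sup>+y. ennreal ((p y / cmod (F1 y))\<^sup>2)
            * indicator {y \<in> {0<..<2*pi}. d \<le> cmod (F1 y) \<and> cmod (F1 y) \<le> 2^N * d} y \<partial>lborel)"
    proof (rule log_crossing_energy[where u = t1 and v = t2])
      fix y
      let ?z = "Complex x y"
      have line: "((\<lambda>y. Complex x y) has_vector_derivative \<i>) (at y)"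
        unfolding Complex_eq by (auto intro!: derivative_eq_intros)
      have "((\<lambda>y. H (Complex x y)) has_vector_derivative \<i> * deriv H ?z) (at y)"
           "((\<lambda>y. G (Complex x y)) has_vector_derivative \<i> * deriv G ?z) (at y)"
        using field_vector_diff_chain_at[OF line] holomorphic_derivI[OF holH \<open>open S\<close> XS[OF x]]
          holomorphic_derivI[OF holG \<open>open S\<close> XS[OF x]] by (auto simp: comp_def)
      then show "(F1 has_vector_derivative (\<i> * deriv H ?z + cnj (\<i> * deriv G ?z))) (at y)"
        unfolding F1_def F_def by (intro has_vector_derivative_add has_vector_derivative_cnj)
      show "cmod (\<i> * deriv H ?z + cnj (\<i> * deriv G ?z)) \<le> p y"
        unfolding p_def by (rule order_trans[OF norm_triangle_ineq]) (simp add: norm_mult)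
    next
      have l: "continuous_on {0..2*pi} (\<lambda>y. Complex x y)" unfolding Complex_eq by (intro continuous_intros)
      have "continuous_on S (deriv H)" "continuous_on S (deriv G)"
        using holH holG \<open>open S\<close> holomorphic_deriv holomorphic_on_imp_continuous_on by blast+
      then show "continuous_on {0..2*pi} p" unfolding p_def
        by (intro continuous_intros continuous_on_compose2[OF _ l]) (use XS[OF x] in auto)
    qed (use d False t1 t2 z1 z2 N in \<open>auto simp: F1_def F d_def\<close>)
    also have "ln ((2^N * d) / d) = L" using d by (simp add: L_def ln_realpow)
    finally have "ennreal (L\<^sup>2) \<le> ennreal (2*pi) * (\<integral>\<^sup>+y. ennreal ((p y / cmod (F1 y))\<^sup>2)
            * indicator {y \<in> {0<..<2*pi}. d \<le> cmod (F1 y) \<and> cmod (F1 y) \<le> 2^N * d} y \<partial>lborel)" by simp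
    also have "\<dots> \<le> ennreal (2*pi) * (\<integral>\<^sup>+y. (\<Sum>k<N. ennreal (c k) * J k (Complex x y)) \<partial>lborel)"
    proof (intro mult_left_mono nn_integral_mono)
      fix y
      let ?z = "Complex x y"
      show "ennreal ((p y / cmod (F1 y))\<^sup>2) * indicator {y \<in> {0<..<2*pi}. d \<le> cmod (F1 y) \<and> cmod (F1 y) \<le> 2^N * d} y
         \<le> (\<Sum>k<N. ennreal (c k) * J k ?z)"
      proof (cases "y \<in> {0<..<2*pi} \<and> d \<le> cmod (F1 y) \<and> cmod (F1 y) \<le> 2^N * d")
        case True
        define P where "P k \<longleftrightarrow> cmod (F1 y) \<le> 2 ^ k * d" for k
        define k where "k = (LEAST k. P (Suc k))"
        have PN: "P (Suc (N - 1))" using True \<open>N \<noteq> 0\<close> by (simp add: P_def)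
        then have Pk: "P (Suc k)" and kN: "k \<le> N - 1" unfolding k_def by (rule LeastI, rule Least_le)
        have "2 ^ k * d \<le> cmod (F1 y)"
        proof (cases k)
          case 0 then show ?thesis using True by simp
        next
          case (Suc j)
          then have "\<not> P (Suc j)" using not_less_Least[of j "\<lambda>k. P (Suc k)"] k_def by simp
          then show ?thesis using Suc by (simp add: P_def)
        qed
        then have zA: "?z \<in> A k" using Pk True x by (simp add: A_def U_def F1_def P_def)
        have "(p y / cmod (F1 y))\<^sup>2 \<le> (p y)\<^sup>2 / (2 ^ k * d)\<^sup>2"
        proof -
          have "0 < 2 ^ k * d" using d by simp
          moreover from this have "0 < cmod (F1 y)" using \<open>2 ^ k * d \<le> cmod (F1 y)\<close> by linarith
          ultimately show ?thesis
            unfolding power_divide using \<open>2 ^ k * d \<le> cmod (F1 y)\<close>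
            by (intro divide_left_mono power_mono mult_pos_pos zero_less_power) (use d in simp_all)
        qed
        also have "\<dots> \<le> K * ((cmod (deriv H ?z))\<^sup>2 - (cmod (deriv G ?z))\<^sup>2) / (2 ^ k * d)\<^sup>2"
          unfolding p_def by (intro divide_right_mono qc' XS x) simp
        also have "\<dots> = c k * ((cmod (deriv H ?z))\<^sup>2 - (cmod (deriv G ?z))\<^sup>2)" by (simp add: c_def)
        finally have "ennreal ((p y / cmod (F1 y))\<^sup>2) \<le> ennreal (c k) * J k ?z"
          using zA c0 by (simp add: J_def ennreal_mult'[symmetric] ennreal_leI)
        also have "\<dots> \<le> (\<Sum>k<N. ennreal (c k) * J k ?z)"
          using kN \<open>N \<noteq> 0\<close> by (intro member_le_sum) auto
        finally show ?thesis using True by simp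
      qed (auto simp: indicator_def)
    qed simp
    also have "\<dots> = ennreal (2 * pi) * (\<Sum>k<N. ennreal (c k) * (\<integral>\<^sup>+y. J k (Complex x y) \<partial>lborel))"
      using Jm2 by (simp add: nn_integral_sum nn_integral_cmult)
    finally show ?thesis using x by simp
  qed simp
  have "ennreal (L\<^sup>2 / 2) = (\<integral>\<^sup>+x. ennreal (L\<^sup>2) * indicator X x \<partial>lborel)"
  proof -
    have "emeasure lborel X = ennreal (1/2)" unfolding X_def by (subst emeasure_lborel_Ioo) simp_all
    moreover have "X \<in> sets lborel" by (simp add: X_def)
    ultimately have "(\<integral>\<^sup>+x. ennreal (L\<^sup>2) * indicator X x \<partial>lborel) = ennreal (L\<^sup>2) * ennreal (1/2)"
      by (simp only: nn_integral_cmult_indicator)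
    also have "\<dots> = ennreal (L\<^sup>2 * (1/2))" by (rule ennreal_mult'[symmetric]) simp
    finally show ?thesis by simp
  qed
  also have "\<dots> \<le> (\<integral>\<^sup>+x. ennreal (2 * pi) * (\<Sum>k<N. ennreal (c k) * (\<integral>\<^sup>+y. J k (Complex x y) \<partial>lborel)) \<partial>lborel)"
    by (rule nn_integral_mono) (rule slice)
  also have "\<dots> = ennreal (2 * pi) * (\<Sum>k<N. ennreal (c k) * (\<integral>\<^sup>+x. \<integral>\<^sup>+y. J k (Complex x y) \<partial>lborel \<partial>lborel))"
    using Jm1 by (simp add: nn_integral_sum nn_integral_cmult)
  also have "\<dots> \<le> ennreal (2 * pi) * (\<Sum>k<N. ennreal (c k) * ennreal (4 * (2 ^ Suc k * d)\<^sup>2))"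
    by (intro mult_left_mono sum_mono area) auto
  also have "(\<Sum>k<N. ennreal (c k) * ennreal (4 * (2 ^ Suc k * d)\<^sup>2)) = (\<Sum>k<N. ennreal (16 * K))"
    using d K by (intro sum.cong refl) (simp add: c_def ennreal_mult'[symmetric] power_mult_distrib field_simps)
  also have "(\<Sum>k<N. ennreal (16 * K)) = ennreal (real N * (16 * K))"
    by (simp only: sum_constant card_lessThan ennreal_of_nat_eq_real_of_nat)
       (rule ennreal_mult'[symmetric], simp)
  also have "ennreal (2 * pi) * \<dots> = ennreal (2 * pi * (real N * (16 * K)))"
    by (rule ennreal_mult'[symmetric]) simp
  finally have "L\<^sup>2 / 2 \<le> 2 * pi * (real N * (16 * K))" using K by (subst (asm) ennreal_le_iff) auto
  then have "real N * (real N * (ln 2)\<^sup>2) \<le> real N * (64 * pi * K)"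
    by (simp add: L_def power_mult_distrib power2_eq_square algebra_simps)
  then show ?thesis by (rule mult_left_le_imp_le) (use False in simp)
qed

section \<open>A Koebe distortion theorem\<close>

text \<open>
  Cauchy's inequality cannot be applied to \<open>p\<close>, whose imaginary part is not controlled, but it
  applies to \<open>q = exp (p / M)\<close>: \<open>|q| \<le> e\<close> on the disk, \<open>|q c| \<ge> 1/e\<close>, and \<open>q' = q p' / M\<close>.
\<close>

lemma norm_deriv_le_of_Re_bounded:
  assumes p: "p holomorphic_on cball c r" and r: "0 < r" and M: "0 < M"
    and bd: "\<And>z. z \<in> cball c r \<Longrightarrow> \<bar>Re (p z)\<bar> \<le> M"
  shows "cmod (deriv p c) \<le> exp 2 * M / r"
proof -
  define q where "q z = exp (p z / of_real M)" for z
  have hol: "q holomorphic_on cball c r" unfolding q_def using M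
    by (intro holomorphic_intros p) auto
  have "cmod ((deriv ^^ 1) q c) \<le> fact 1 * exp 1 / r ^ 1"
  proof (rule Cauchy_inequality)
    show "q holomorphic_on ball c r" using hol by (rule holomorphic_on_subset) auto
    show "continuous_on (cball c r) q" using hol by (rule holomorphic_on_imp_continuous_on)
    fix z assume "cmod (c - z) = r"
    then have "\<bar>Re (p z)\<bar> \<le> M" by (intro bd) (auto simp: dist_norm)
    then show "cmod (q z) \<le> exp 1" using M by (simp add: q_def divide_le_eq abs_le_iff)
  qed (rule r)
  moreover have "deriv q c = q c * (deriv p c / of_real M)"
  proof (rule DERIV_imp_deriv)
    have "p holomorphic_on ball c r" using p by (rule holomorphic_on_subset) auto
    then have "(p has_field_derivative deriv p c) (at c)"
      using r by (intro holomorphic_derivI[of _ "ball c r"]) auto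
    then show "(q has_field_derivative q c * (deriv p c / of_real M)) (at c)"
      unfolding q_def using M by (auto intro!: derivative_eq_intros)
  qed
  ultimately have 1: "cmod (q c) * (cmod (deriv p c) / M) \<le> exp 1 / r"
    using M by (simp add: norm_mult norm_divide)
  have "exp (-1) \<le> cmod (q c)"
    using bd[of c] r M by (simp add: q_def le_divide_eq abs_le_iff)
  then have "exp (-1) * (cmod (deriv p c) / M) \<le> cmod (q c) * (cmod (deriv p c) / M)"
    using M by (intro mult_right_mono) auto
  with 1 have "exp (-1) * (cmod (deriv p c) / M) \<le> exp 1 / r" by linarith
  then have "exp 1 * (exp (-1) * (cmod (deriv p c) / M)) \<le> exp 1 * (exp 1 / r)"
    by (intro mult_left_mono) auto
  then have "cmod (deriv p c) / M \<le> exp 2 / r"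
    by (simp add: mult.assoc[symmetric] exp_add[symmetric])
  then show ?thesis using M by (simp add: pos_divide_le_eq)
qed

text \<open>
  The exponent of \<open>2\<close> is the least natural number that exceeds the bound for \<open>N\<close> given by
  \<open>dyadic_growth\<close>; the factor \<open>2 e\<^sup>2\<close> is the constant of \<open>norm_deriv_le_of_Re_bounded\<close> for a disk of
  radius \<open>1/2\<close>.
\<close>

definition koebe_const :: "real \<Rightarrow> real" where
  "koebe_const K = 2 * exp 2 * 2 ^ (nat \<lfloor>64 * pi * K / (ln 2)\<^sup>2\<rfloor> + 1)"

lemma koebe_const_pos: "koebe_const K > 0" by (simp add: koebe_const_def)

text \<open>
  On the disk of radius \<open>1/2\<close>, \<open>|f| \<le> 2\<^sup>N |f 0|\<close> with \<open>N\<close> depending only on \<open>K\<close>. The real and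
  imaginary parts of \<open>f\<close> are the real parts of the holomorphic functions \<open>h + g\<close> and
  \<open>\<i> (g - h)\<close>, so the derivatives of both at \<open>0\<close> are controlled, and with them that of \<open>h\<close>.
\<close>

lemma norm_deriv_le_dist_omitted_unit:
  fixes h g :: "complex \<Rightarrow> complex"
  defines "f \<equiv> \<lambda>z. h z + cnj (g z)"
  assumes h: "h holomorphic_on ball 0 1" and g: "g holomorphic_on ball 0 1"
    and inj: "inj_on f (ball 0 1)" and omit: "0 \<notin> f ` ball 0 1"
    and qc: "\<And>z. z \<in> ball 0 1 \<Longrightarrow>
       (cmod (deriv h z) + cmod (deriv g z))\<^sup>2 \<le> K * ((cmod (deriv h z))\<^sup>2 - (cmod (deriv g z))\<^sup>2)"
    and K: "K \<ge> 1"
  shows "cmod (deriv h 0) \<le> koebe_const K * cmod (f 0)"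
proof -
  define N where "N = nat \<lfloor>64 * pi * K / (ln 2)\<^sup>2\<rfloor> + 1"
  define M where "M = 2 ^ N * cmod (f 0)"
  have "f 0 \<noteq> 0" using omit by force
  then have M: "M > 0" by (simp add: M_def)
  have "real N > 64 * pi * K / (ln 2)\<^sup>2" unfolding N_def by linarith
  then have Nbig: "real N * (ln 2)\<^sup>2 > 64 * pi * K" by (simp add: pos_divide_less_eq)
  have fM: "cmod (f z) \<le> M" if "z \<in> cball 0 (1/2)" for z
    using dyadic_growth[OF h g inj[unfolded f_def] omit[unfolded f_def] qc K, of z N] that Nbig
    unfolding M_def f_def by fastforce
  have sub: "cball 0 (1/2) \<subseteq> ball (0::complex) 1" by auto
  note hol = holomorphic_on_subset[OF h sub] holomorphic_on_subset[OF g sub]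
  have d: "h field_differentiable (at 0)" "g field_differentiable (at 0)"
    using h g by (auto simp: holomorphic_on_imp_differentiable_at)
  have "cmod (deriv (\<lambda>z. h z + g z) 0) \<le> exp 2 * M / (1/2)"
  proof (rule norm_deriv_le_of_Re_bounded)
    fix z :: complex assume "z \<in> cball 0 (1/2)"
    from fM[OF this] show "\<bar>Re (h z + g z)\<bar> \<le> M"
      using abs_Re_le_cmod[of "f z"] by (simp add: f_def)
  qed (use hol M in \<open>auto intro!: holomorphic_intros\<close>)
  then have 1: "cmod (deriv h 0 + deriv g 0) \<le> 2 * (exp 2 * M)" using d by (simp add: deriv_add)
  have "cmod (deriv (\<lambda>z. \<i> * (g z - h z)) 0) \<le> exp 2 * M / (1/2)"
  proof (rule norm_deriv_le_of_Re_bounded)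
    fix z :: complex assume "z \<in> cball 0 (1/2)"
    from fM[OF this] show "\<bar>Re (\<i> * (g z - h z))\<bar> \<le> M"
      using abs_Im_le_cmod[of "f z"] by (simp add: f_def abs_minus_commute)
  qed (use hol M in \<open>auto intro!: holomorphic_intros\<close>)
  then have 2: "cmod (deriv g 0 - deriv h 0) \<le> 2 * (exp 2 * M)"
    using d by (simp add: deriv_cmult deriv_diff field_differentiable_diff norm_mult)
  have "deriv h 0 = ((deriv h 0 + deriv g 0) - (deriv g 0 - deriv h 0)) / 2" by simp
  then have "cmod (deriv h 0) \<le> (cmod (deriv h 0 + deriv g 0) + cmod (deriv g 0 - deriv h 0)) / 2"
    by (metis divide_right_mono norm_divide norm_numeral norm_triangle_ineq4 zero_le_numeral)
  also have "\<dots> \<le> 2 * (exp 2 * M)" using 1 2 by simp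
  also have "\<dots> = koebe_const K * cmod (f 0)" by (simp add: koebe_const_def M_def N_def)
  finally show ?thesis .
qed

text \<open>
  The replacement for Koebe's one-quarter theorem: a point of the image is at distance at least a
  constant multiple of \<open>R |h' c|\<close> from every omitted value. Translation and scaling reduce it to
  the unit disk and the omitted value \<open>0\<close>.
\<close>

lemma norm_deriv_le_dist_omitted:
  fixes h g :: "complex \<Rightarrow> complex"
  defines "f \<equiv> \<lambda>z. h z + cnj (g z)"
  assumes h: "h holomorphic_on ball c R" and g: "g holomorphic_on ball c R"
    and inj: "inj_on f (ball c R)" and omit: "w \<notin> f ` ball c R"
    and qc: "\<And>z. z \<in> ball c R \<Longrightarrow>
       (cmod (deriv h z) + cmod (deriv g z))\<^sup>2 \<le> K * ((cmod (deriv h z))\<^sup>2 - (cmod (deriv g z))\<^sup>2)"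
    and K: "K \<ge> 1" and R: "R > 0"
  shows "R * cmod (deriv h c) \<le> koebe_const K * dist (f c) w"
proof -
  define a where "a z = c + of_real R * z" for z
  have a: "a z \<in> ball c R" if "z \<in> ball 0 1" for z
    using that R by (simp add: a_def dist_norm norm_mult)
  define h1 where "h1 z = h (a z) - w" for z
  define g1 where "g1 z = g (a z)" for z
  have da: "(a has_field_derivative of_real R) (at z)" for z
    unfolding a_def by (auto intro!: derivative_eq_intros)
  have dh: "(h1 has_field_derivative deriv h (a z) * of_real R) (at z)"
    and dg: "(g1 has_field_derivative deriv g (a z) * of_real R) (at z)" if "z \<in> ball 0 1" for z
    using DERIV_chain2[OF holomorphic_derivI[OF h open_ball a[OF that]] da]
      DERIV_chain2[OF holomorphic_derivI[OF g open_ball a[OF that]] da]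
    unfolding h1_def g1_def by (auto intro!: derivative_eq_intros)
  have eq: "h1 z + cnj (g1 z) = f (a z) - w" for z by (simp add: h1_def g1_def f_def)
  have "cmod (deriv h1 0) \<le> koebe_const K * cmod (h1 0 + cnj (g1 0))"
  proof (rule norm_deriv_le_dist_omitted_unit)
    show "h1 holomorphic_on ball 0 1" "g1 holomorphic_on ball 0 1"
      unfolding holomorphic_on_open[OF open_ball] using dh dg by blast+
    show "inj_on (\<lambda>z. h1 z + cnj (g1 z)) (ball 0 1)"
    proof (rule inj_onI)
      fix y z :: complex assume yz: "y \<in> ball 0 1" "z \<in> ball 0 1" "h1 y + cnj (g1 y) = h1 z + cnj (g1 z)"
      then have "a y = a z" using inj_onD[OF inj] a by (simp add: eq)
      then show "y = z" using R by (simp add: a_def)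
    qed
    show "0 \<notin> (\<lambda>z. h1 z + cnj (g1 z)) ` ball 0 1" using omit a by (auto simp: eq)
    fix z :: complex assume z: "z \<in> ball 0 1"
    have "R\<^sup>2 * (cmod (deriv h (a z)) + cmod (deriv g (a z)))\<^sup>2
       \<le> R\<^sup>2 * (K * ((cmod (deriv h (a z)))\<^sup>2 - (cmod (deriv g (a z)))\<^sup>2))"
      by (rule mult_left_mono[OF qc[OF a[OF z]]]) simp
    then show "(cmod (deriv h1 z) + cmod (deriv g1 z))\<^sup>2 \<le> K * ((cmod (deriv h1 z))\<^sup>2 - (cmod (deriv g1 z))\<^sup>2)"
      using DERIV_imp_deriv[OF dh[OF z]] DERIV_imp_deriv[OF dg[OF z]] R
      by (simp add: norm_mult power2_eq_square algebra_simps)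
  qed (rule K)
  then show ?thesis
    using DERIV_imp_deriv[OF dh[of 0]] R unfolding eq
    by (simp add: norm_mult a_def dist_norm mult.commute)
qed

section \<open>Pre-Schwarzian derivative, Jacobian and length along rays\<close>

text \<open>
  For an inscribed polygon the increments of \<open>B\<close> telescope.
\<close>

lemma curve_length_le:
  assumes "a \<le> b" and B: "\<And>u v. a \<le> u \<Longrightarrow> u \<le> v \<Longrightarrow> v \<le> b \<Longrightarrow> dist (\<gamma> u) (\<gamma> v) \<le> B v - B u"
  shows "curve_length \<gamma> a b \<le> ennreal (B b - B a)"
  unfolding curve_length_def
proof (rule SUP_least)
  fix ts assume "ts \<in> {ts. sorted ts \<and> set ts \<subseteq> {a..b}}"
  then have ts: "sorted ts" "\<And>i. i < length ts \<Longrightarrow> ts ! i \<in> {a..b}" by (auto simp: subset_iff)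
  have B0: "B u \<le> B v" if "a \<le> u" "u \<le> v" "v \<le> b" for u v
    using order_trans[OF zero_le_dist B[OF that]] by simp
  have "(\<Sum>i<length ts - 1. dist (\<gamma> (ts ! i)) (\<gamma> (ts ! Suc i)))
      \<le> (\<Sum>i<length ts - 1. B (ts ! Suc i) - B (ts ! i))"
  proof (rule sum_mono)
    fix i assume "i \<in> {..<length ts - 1}"
    then have i: "i < length ts" "Suc i < length ts" by auto
    then show "dist (\<gamma> (ts ! i)) (\<gamma> (ts ! Suc i)) \<le> B (ts ! Suc i) - B (ts ! i)"
      using ts(2)[OF i(1)] ts(2)[OF i(2)] sorted_nth_mono[OF ts(1), of i "Suc i"] by (intro B) auto
  qed
  also have "\<dots> = B (ts ! (length ts - 1)) - B (ts ! 0)"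
    by (rule sum_lessThan_telescope)
  also have "\<dots> \<le> B b - B a"
  proof (cases "ts = []")
    case True then show ?thesis using B0[of a b] \<open>a \<le> b\<close> by simp
  next
    case False
    then have "ts ! (length ts - 1) \<in> {a..b}" "ts ! 0 \<in> {a..b}" using ts(2) by auto
    then show ?thesis using B0[of a "ts ! 0"] B0[of "ts ! (length ts - 1)" b] by auto
  qed
  finally show "ennreal (\<Sum>i<length ts - 1. dist (\<gamma> (ts ! i)) (\<gamma> (ts ! Suc i))) \<le> ennreal (B b - B a)"
    by (rule ennreal_leI)
qed

text \<open>
  The pre-Schwarzian derivative is \<open>\<partial>J / J\<close>, where \<open>\<partial> = \<partial>/\<partial>z\<close> and \<open>J = h' cnj h' - g' cnj g'\<close>
  is the Jacobian; the right-hand side is \<open>\<partial>J\<close>.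
\<close>

lemma pre_Schwarzian_mult_jacobian:
  assumes h: "h holomorphic_on S" and g: "g holomorphic_on S" and "open S" "z \<in> S"
    and lt: "cmod (deriv g z) < cmod (deriv h z)"
  shows "pre_Schwarzian h g z * of_real ((cmod (deriv h z))\<^sup>2 - (cmod (deriv g z))\<^sup>2)
       = deriv (deriv h) z * cnj (deriv h z) - deriv (deriv g) z * cnj (deriv g z)"
proof -
  define a b where "a = deriv h z" and "b = deriv g z"
  have a0: "a \<noteq> 0" using lt by (auto simp: a_def)
  have "deriv h holomorphic_on S" "deriv g holomorphic_on S"
    using assms holomorphic_deriv by blast+
  then have "(deriv h has_field_derivative deriv (deriv h) z) (at z)"
    "(deriv g has_field_derivative deriv (deriv g) z) (at z)"
    using assms holomorphic_derivI by blast+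
  then have "((\<lambda>z. deriv g z / deriv h z) has_field_derivative
      (deriv (deriv g) z * a - b * deriv (deriv h) z) / (a * a)) (at z)"
    using a0 unfolding a_def b_def by (intro DERIV_divide) auto
  then have dw: "deriv (dilatation h g) z = (deriv (deriv g) z * a - b * deriv (deriv h) z) / (a * a)"
    using DERIV_imp_deriv unfolding dilatation_def[abs_def] by blast
  define D where "D = a * cnj a - b * cnj b"
  have D: "of_real ((cmod a)\<^sup>2 - (cmod b)\<^sup>2) = D"
    by (simp only: of_real_diff complex_norm_square D_def)
  have "(cmod b)\<^sup>2 < (cmod a)\<^sup>2" using lt by (intro power_strict_mono) (auto simp: a_def b_def)
  then have "of_real ((cmod a)\<^sup>2 - (cmod b)\<^sup>2) \<noteq> (0::complex)"
    by (auto simp del: of_real_diff of_real_power)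
  then have D0: "D \<noteq> 0" using D by metis
  have "of_real (1 - (cmod (b / a))\<^sup>2) = 1 - (b / a) * cnj (b / a)"
    by (simp only: of_real_diff complex_norm_square of_real_1)
  also have "\<dots> = D / (a * cnj a)" using a0 by (simp add: D_def field_simps)
  finally have w: "of_real (1 - (cmod (b / a))\<^sup>2) = D / (a * cnj a)" .
  have "pre_Schwarzian h g z * of_real ((cmod a)\<^sup>2 - (cmod b)\<^sup>2) =
      (deriv (deriv h) z / a - (deriv (deriv g) z * a - b * deriv (deriv h) z) / (a * a)
         * cnj (b / a) / (D / (a * cnj a))) * D"
    unfolding pre_Schwarzian_def dw D w[symmetric] by (simp only: dilatation_def a_def b_def)
  also have "\<dots> = deriv (deriv h) z * (D / a)
       - (deriv (deriv g) z * a - b * deriv (deriv h) z) * (cnj b / a)"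
    using a0 D0 by (simp add: field_simps)
  also have "\<dots> = deriv (deriv h) z * cnj a - deriv (deriv g) z * cnj b"
    using a0 by (simp add: D_def field_simps)
  finally show ?thesis by (simp only: a_def b_def)
qed

text \<open>
  With \<open>z = \<rho> \<zeta>\<close>, the derivative of \<open>J \<rho> (1 / \<rho>\<^sup>2 - 1)\<close> is
  \<open>(2 J \<rho> / \<rho>\<^sup>3) ((1 - \<rho>\<^sup>2) Re (z P\<^sub>f z) - 1)\<close>. At a zero of \<open>h'\<close> the inequality for \<open>K\<close> forces
  \<open>g' = 0\<close>, and the derivative is zero.
\<close>

lemma jacobian_ray_decay:
  fixes h g :: "complex \<Rightarrow> complex" and \<zeta> :: complex
  defines "J \<equiv> \<lambda>\<rho>. (cmod (deriv h (of_real \<rho> * \<zeta>)))\<^sup>2 - (cmod (deriv g (of_real \<rho> * \<zeta>)))\<^sup>2"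
  assumes h: "h holomorphic_on ball 0 1" and g: "g holomorphic_on ball 0 1"
    and \<zeta>: "cmod \<zeta> = 1" and sr: "0 < s" "s \<le> r" "r < 1"
    and qc: "\<And>z. z \<in> ball 0 1 \<Longrightarrow>
       (cmod (deriv h z) + cmod (deriv g z))\<^sup>2 \<le> K * ((cmod (deriv h z))\<^sup>2 - (cmod (deriv g z))\<^sup>2)"
    and K: "K \<ge> 1"
    and P: "\<And>z. s \<le> cmod z \<Longrightarrow> cmod z \<le> r \<Longrightarrow> (1 - (cmod z)\<^sup>2) * Re (z * pre_Schwarzian h g z) \<le> 1"
  shows "J r * (1 / r\<^sup>2 - 1) \<le> J s * (1 / s\<^sup>2 - 1)"
proof (rule DERIV_nonpos_imp_nonincreasing[OF \<open>s \<le> r\<close>])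
  fix \<rho> assume \<rho>: "s \<le> \<rho>" "\<rho> \<le> r"
  define z where "z = of_real \<rho> * \<zeta>"
  have nz: "cmod z = \<rho>" using \<rho> sr \<zeta> by (simp add: z_def norm_mult)
  then have zb: "z \<in> ball 0 1" using \<rho> sr by simp
  have line: "((\<lambda>\<rho>. of_real \<rho> * \<zeta>) has_vector_derivative \<zeta>) (at \<rho>)"
    by (auto intro!: derivative_eq_intros)
  have sq: "((\<lambda>\<rho>. (cmod (F (of_real \<rho> * \<zeta>)))\<^sup>2) has_real_derivative
       2 * Re (\<zeta> * (deriv F z * cnj (F z)))) (at \<rho>)" if "F holomorphic_on ball 0 1" for F
  proof -
    have "(F has_field_derivative deriv F z) (at z)"
      using holomorphic_derivI[OF that open_ball zb] .
    then have "((\<lambda>\<rho>. F (of_real \<rho> * \<zeta>)) has_vector_derivative \<zeta> * deriv F z) (at \<rho>)"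
      using field_vector_diff_chain_at[OF line] by (simp add: comp_def z_def)
    from bounded_bilinear.has_vector_derivative[OF bounded_bilinear_inner this this]
    show ?thesis
      by (simp add: has_real_derivative_iff_has_vector_derivative power2_norm_eq_inner z_def
           inner_complex_def algebra_simps)
  qed
  have "deriv h holomorphic_on ball 0 1" "deriv g holomorphic_on ball 0 1"
    using h g holomorphic_deriv by blast+
  note dd = sq[OF this(1)] sq[OF this(2)]
  define E where "E = Re (\<zeta> * (deriv (deriv h) z * cnj (deriv h z) - deriv (deriv g) z * cnj (deriv g z)))"
  have dJ: "(J has_real_derivative 2 * E) (at \<rho>)"
    using DERIV_diff[OF dd] unfolding J_def E_def by (simp add: algebra_simps)
  have \<rho>0: "\<rho> > 0" using \<rho> sr by simp
  have D: "((\<lambda>\<rho>. J \<rho> * (1 / \<rho>\<^sup>2 - 1)) has_real_derivative 2 * E * (1 / \<rho>\<^sup>2 - 1) - J \<rho> * (2 / \<rho> ^ 3)) (at \<rho>)"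
    using \<rho>0 by (auto intro!: derivative_eq_intros dJ simp: field_simps power2_eq_square power3_eq_cube)
  have "2 * E * (1 / \<rho>\<^sup>2 - 1) - J \<rho> * (2 / \<rho> ^ 3) \<le> 0"
  proof (cases "deriv h z = 0")
    case True
    then have "(cmod (deriv g z))\<^sup>2 \<le> - (K * (cmod (deriv g z))\<^sup>2)" using qc[OF zb] by simp
    moreover have "K * (cmod (deriv g z))\<^sup>2 \<ge> 0" using K by simp
    ultimately have "(cmod (deriv g z))\<^sup>2 \<le> 0" by linarith
    then have "deriv g z = 0" by simp
    then show ?thesis using True by (simp add: E_def J_def z_def)
  next
    case False
    have "0 < (cmod (deriv h z) + cmod (deriv g z))\<^sup>2" using False by (intro zero_less_power add_pos_nonneg) auto
    also note qc[OF zb]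
    finally have J0: "0 < (cmod (deriv h z))\<^sup>2 - (cmod (deriv g z))\<^sup>2" using K by (simp add: zero_less_mult_iff)
    then have lt: "cmod (deriv g z) < cmod (deriv h z)" by (simp add: power_less_imp_less_base)
    have JP: "J \<rho> > 0" using J0 by (simp add: J_def z_def)
    have "E = Re (\<zeta> * (pre_Schwarzian h g z * of_real (J \<rho>)))"
      using pre_Schwarzian_mult_jacobian[OF h g open_ball zb lt] by (simp add: E_def J_def z_def)
    also have "\<dots> = Re (\<zeta> * pre_Schwarzian h g z) * J \<rho>"
      by (simp add: mult.assoc[symmetric])
    finally have E: "E = Re (\<zeta> * pre_Schwarzian h g z) * J \<rho>" .
    have "Re (z * pre_Schwarzian h g z) = \<rho> * Re (\<zeta> * pre_Schwarzian h g z)"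
      by (simp add: z_def mult.assoc)
    with P[of z] nz \<rho> have "(1 - \<rho>\<^sup>2) * (\<rho> * Re (\<zeta> * pre_Schwarzian h g z)) \<le> 1" by simp
    then have "(2 * J \<rho> / \<rho> ^ 3) * ((1 - \<rho>\<^sup>2) * (\<rho> * Re (\<zeta> * pre_Schwarzian h g z)) - 1) \<le> 0"
      using JP \<rho>0 by (intro mult_nonneg_nonpos) auto
    also have "(2 * J \<rho> / \<rho> ^ 3) * ((1 - \<rho>\<^sup>2) * (\<rho> * Re (\<zeta> * pre_Schwarzian h g z)) - 1)
       = 2 * E * (1 / \<rho>\<^sup>2 - 1) - J \<rho> * (2 / \<rho> ^ 3)"
      unfolding E using \<rho>0 by (simp add: field_simps power2_eq_square power3_eq_cube)
    finally show ?thesis .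
  qed
  with D show "\<exists>y. ((\<lambda>\<rho>. J \<rho> * (1 / \<rho>\<^sup>2 - 1)) has_real_derivative y) (at \<rho>) \<and> y \<le> 0" by blast
qed

text \<open>
  The function \<open>\<rho> \<mapsto> C1 \<rho> - C2 sqrt (1 - \<rho>\<^sup>2)\<close> is a primitive of the bound for the speed. The
  summand with \<open>C1\<close> covers the part of the ray near the centre, that with \<open>C2\<close> the part near the
  unit circle.
\<close>

lemma radial_length_le:
  fixes f h g :: "complex \<Rightarrow> complex"
  assumes h: "h holomorphic_on ball 0 1" and g: "g holomorphic_on ball 0 1"
    and f: "\<And>z. z \<in> ball 0 1 \<Longrightarrow> f z = h z + cnj (g z)"
    and z1: "z1 \<in> ball 0 1" and a: "0 \<le> a" "a \<le> 1"
    and D: "\<And>\<tau>. a \<le> \<tau> \<Longrightarrow> \<tau> \<le> 1 \<Longrightarrow>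
        cmod (deriv h (of_real \<tau> * z1)) + cmod (deriv g (of_real \<tau> * z1))
          \<le> C1 + C2 * (\<tau> * cmod z1 / sqrt (1 - (\<tau> * cmod z1)\<^sup>2))"
  shows "curve_length (radial_curve f z1) a 1
     \<le> ennreal (C1 * ((1 - a) * cmod z1) + C2 * (sqrt (1 - (a * cmod z1)\<^sup>2) - sqrt (1 - (cmod z1)\<^sup>2)))"
proof -
  define B where "B \<tau> = C1 * (\<tau> * cmod z1) - C2 * sqrt (1 - (\<tau> * cmod z1)\<^sup>2)" for \<tau>
  have ball: "of_real \<tau> * z1 \<in> ball 0 1" "\<tau> * cmod z1 < 1" "(\<tau> * cmod z1)\<^sup>2 < 1"
    if "a \<le> \<tau>" "\<tau> \<le> 1" for \<tau>
  proof -
    have "\<tau> * cmod z1 \<le> 1 * cmod z1" using that a by (intro mult_right_mono) auto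
    then show lt: "\<tau> * cmod z1 < 1" using z1 by simp
    then show "of_real \<tau> * z1 \<in> ball 0 1" using that a by (simp add: norm_mult)
    show "(\<tau> * cmod z1)\<^sup>2 < 1" using lt that a by (simp add: power_less_one_iff)
  qed
  define fh where "fh z = h z + cnj (g z)" for z
  have dcurve: "((\<lambda>\<tau>. fh (of_real \<tau> * z1)) has_vector_derivative
      (z1 * deriv h (of_real \<tau> * z1) + cnj (z1 * deriv g (of_real \<tau> * z1)))) (at \<tau>)"
    if "a \<le> \<tau>" "\<tau> \<le> 1" for \<tau>
  proof -
    have line: "((\<lambda>\<rho>. of_real \<rho> * z1) has_vector_derivative z1) (at \<tau>)"
      by (auto intro!: derivative_eq_intros)
    have "((\<lambda>\<tau>. h (of_real \<tau> * z1)) has_vector_derivative z1 * deriv h (of_real \<tau> * z1)) (at \<tau>)"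
      "((\<lambda>\<tau>. g (of_real \<tau> * z1)) has_vector_derivative z1 * deriv g (of_real \<tau> * z1)) (at \<tau>)"
      using field_vector_diff_chain_at[OF line] holomorphic_derivI[OF h open_ball ball(1)[OF that]]
         holomorphic_derivI[OF g open_ball ball(1)[OF that]] by (auto simp: comp_def)
    then show ?thesis unfolding fh_def by (intro has_vector_derivative_add has_vector_derivative_cnj)
  qed
  have dB: "(B has_real_derivative
      cmod z1 * (C1 + C2 * (\<tau> * cmod z1 / sqrt (1 - (\<tau> * cmod z1)\<^sup>2)))) (at \<tau>)"
    if "a \<le> \<tau>" "\<tau> \<le> 1" for \<tau>
    unfolding B_def using ball(3)[OF that]
    by (auto intro!: derivative_eq_intros simp: field_simps power2_eq_square)
  have "curve_length (radial_curve f z1) a 1 \<le> ennreal (B 1 - B a)"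
  proof (rule curve_length_le[OF a(2)])
    fix u v assume uv: "a \<le> u" "u \<le> v" "v \<le> 1"
    have eq: "radial_curve f z1 \<tau> = fh (of_real \<tau> * z1)" if "a \<le> \<tau>" "\<tau> \<le> 1" for \<tau>
      using f[OF ball(1)[OF that]] by (simp add: radial_curve_def fh_def)
    show "dist (radial_curve f z1 u) (radial_curve f z1 v) \<le> B v - B u"
    proof (cases "u = v")
      case False
      then have "u < v" using uv by simp
      have "norm (fh (of_real v * z1) - fh (of_real u * z1)) \<le> B v - B u"
      proof (rule differentiable_bound_general[OF \<open>u < v\<close>])
        show "continuous_on {u..v} (\<lambda>\<tau>. fh (of_real \<tau> * z1))"
          using uv by (intro continuous_at_imp_continuous_on ballI has_vector_derivative_continuous[OF dcurve]) auto
        show "continuous_on {u..v} B"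
          using uv by (intro continuous_at_imp_continuous_on ballI DERIV_isCont[OF dB]) auto
        fix x assume x: "u < x" "x < v"
        then have xa: "a \<le> x" "x \<le> 1" using uv by auto
        show "((\<lambda>\<tau>. fh (of_real \<tau> * z1)) has_vector_derivative
            (z1 * deriv h (of_real x * z1) + cnj (z1 * deriv g (of_real x * z1)))) (at x)"
          by (rule dcurve[OF xa])
        show "(B has_vector_derivative
            cmod z1 * (C1 + C2 * (x * cmod z1 / sqrt (1 - (x * cmod z1)\<^sup>2)))) (at x)"
          using dB[OF xa] by (simp add: has_real_derivative_iff_has_vector_derivative)
        have "cmod (z1 * deriv h (of_real x * z1) + cnj (z1 * deriv g (of_real x * z1)))
           \<le> cmod z1 * (cmod (deriv h (of_real x * z1)) + cmod (deriv g (of_real x * z1)))"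
          by (rule order_trans[OF norm_triangle_ineq]) (simp add: norm_mult algebra_simps)
        also have "\<dots> \<le> cmod z1 * (C1 + C2 * (x * cmod z1 / sqrt (1 - (x * cmod z1)\<^sup>2)))"
          by (intro mult_left_mono D xa) simp
        finally show "cmod (z1 * deriv h (of_real x * z1) + cnj (z1 * deriv g (of_real x * z1)))
            \<le> cmod z1 * (C1 + C2 * (x * cmod z1 / sqrt (1 - (x * cmod z1)\<^sup>2)))" .
      qed
      then show ?thesis using uv by (simp add: eq dist_norm norm_minus_commute)
    qed simp
  qed
  also have "B 1 - B a = C1 * ((1 - a) * cmod z1) + C2 * (sqrt (1 - (a * cmod z1)\<^sup>2) - sqrt (1 - (cmod z1)\<^sup>2))"
    by (simp add: B_def algebra_simps)
  finally show ?thesis .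
qed

section \<open>Quasiconformal harmonic maps and radial John disks\<close>

text \<open>
  Since \<open>f = h + cnj g\<close> is known only on the disk, the derivative is computed for \<open>h + cnj g\<close> and
  transferred to \<open>f\<close> in a neighbourhood of \<open>z\<close>. Taking \<open>v = 1\<close> and \<open>v = \<i>\<close> yields
  \<open>f\<^sub>z = h'\<close> and that the derivative in \<open>cnj z\<close> is \<open>cnj g'\<close>.
\<close>

lemma pderiv_along_canonical_rep:
  assumes "canonical_rep f h g" and z: "z \<in> ball 0 1"
  shows "pderiv_along v f z = v * deriv h z + cnj (v * deriv g z)"
  unfolding pderiv_along_def
proof (rule vector_derivative_at)
  have h: "h holomorphic_on ball 0 1" and g: "g holomorphic_on ball 0 1"
    and f: "\<And>z. z \<in> ball 0 1 \<Longrightarrow> f z = h z + cnj (g z)"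
    using assms(1) by (auto simp: canonical_rep_def)
  have line: "((\<lambda>t. z + of_real t * v) has_vector_derivative v) (at 0)"
    by (auto intro!: derivative_eq_intros)
  have zz: "z + of_real 0 * v \<in> ball 0 1" using z by simp
  have "((\<lambda>t. h (z + of_real t * v)) has_vector_derivative v * deriv h z) (at 0)"
    "((\<lambda>t. g (z + of_real t * v)) has_vector_derivative v * deriv g z) (at 0)"
    using field_vector_diff_chain_at[OF line] holomorphic_derivI[OF h open_ball zz]
      holomorphic_derivI[OF g open_ball zz] by (auto simp: comp_def)
  then have d: "((\<lambda>t. h (z + of_real t * v) + cnj (g (z + of_real t * v)))
      has_vector_derivative v * deriv h z + cnj (v * deriv g z)) (at 0)"
    by (intro has_vector_derivative_add has_vector_derivative_cnj)
  have op: "open ((\<lambda>t::real. z + of_real t * v) -` ball 0 1)"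
    by (intro open_vimage continuous_intros) auto
  show "((\<lambda>t. f (z + of_real t * v)) has_vector_derivative v * deriv h z + cnj (v * deriv g z)) (at 0)"
    by (rule has_vector_derivative_transform_within_open[OF d op]) (use zz f in auto)
qed

lemma quasiconformal_deriv_ineq:
  assumes "quasiconformal K f (ball 0 1) T" and "canonical_rep f h g" and "z \<in> ball 0 1"
  shows "(cmod (deriv h z) + cmod (deriv g z))\<^sup>2 \<le> K * ((cmod (deriv h z))\<^sup>2 - (cmod (deriv g z))\<^sup>2)"
proof -
  have "d_z f z = deriv h z" "d_zbar f z = cnj (deriv g z)"
    by (simp_all add: d_z_def d_zbar_def pderiv_along_canonical_rep[OF assms(2,3)] algebra_simps)
  moreover have "(norm_D f z)\<^sup>2 \<le> K * det_D f z" using assms by (auto simp: quasiconformal_def)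
  ultimately show ?thesis by (simp add: norm_D_def det_D_def)
qed

text \<open>
  The nearest boundary point is a value that \<open>f\<close> omits, and the disk about \<open>z\<close> of radius
  \<open>1 - |z|\<close> lies in the unit disk.
\<close>

lemma norm_deriv_le_infdist:
  fixes h g :: "complex \<Rightarrow> complex"
  assumes rep: "canonical_rep f h g" and qc: "quasiconformal K f (ball 0 1) (f ` ball 0 1)"
    and inj: "inj_on f (ball 0 1)" and bdd: "bounded (f ` ball 0 1)" and z: "z \<in> ball 0 1"
  shows "(1 - cmod z) * cmod (deriv h z) \<le> koebe_const K * infdist (f z) (frontier (f ` ball 0 1))"
proof -
  let ?G = "f ` ball 0 1"
  have h: "h holomorphic_on ball 0 1" and g: "g holomorphic_on ball 0 1"
    and f: "\<And>z. z \<in> ball 0 1 \<Longrightarrow> f z = h z + cnj (g z)"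
    using rep by (auto simp: canonical_rep_def)
  have "open ?G" and K: "K \<ge> 1" using qc by (auto simp: quasiconformal_def)
  have "?G \<noteq> UNIV" using bdd not_bounded_UNIV by metis
  then have "frontier ?G \<noteq> {}" using frontier_eq_empty[of ?G] by auto
  then obtain w where w: "w \<in> frontier ?G" "infdist (f z) (frontier ?G) = dist (f z) w"
    using infdist_attains_inf[OF frontier_closed] by blast
  have wG: "w \<notin> ?G" using w(1) \<open>open ?G\<close> by (simp add: frontier_def interior_open)
  have sub: "ball z (1 - cmod z) \<subseteq> ball 0 1"
  proof
    fix y assume "y \<in> ball z (1 - cmod z)"
    then show "y \<in> ball 0 1" using norm_triangle_sub[of y z] by (simp add: dist_norm norm_minus_commute)
  qed
  have "(1 - cmod z) * cmod (deriv h z) \<le> koebe_const K * dist (h z + cnj (g z)) w"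
  proof (rule norm_deriv_le_dist_omitted)
    show "inj_on (\<lambda>z. h z + cnj (g z)) (ball z (1 - cmod z))"
    proof (rule inj_onI)
      fix x y assume xy: "x \<in> ball z (1 - cmod z)" "y \<in> ball z (1 - cmod z)"
        "h x + cnj (g x) = h y + cnj (g y)"
      then have "x \<in> ball 0 1" "y \<in> ball 0 1" using sub by blast+
      then show "x = y" using inj_onD[OF inj] f xy(3) by metis
    qed
    show "w \<notin> (\<lambda>z. h z + cnj (g z)) ` ball z (1 - cmod z)"
    proof
      assume "w \<in> (\<lambda>z. h z + cnj (g z)) ` ball z (1 - cmod z)"
      then obtain y where "y \<in> ball z (1 - cmod z)" "w = h y + cnj (g y)" by blast
      then have "y \<in> ball 0 1" "w = f y" using sub f[of y] by auto
      then show False using wG by blast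
    qed
    show "(cmod (deriv h y) + cmod (deriv g y))\<^sup>2 \<le> K * ((cmod (deriv h y))\<^sup>2 - (cmod (deriv g y))\<^sup>2)"
      if "y \<in> ball z (1 - cmod z)" for y
      using quasiconformal_deriv_ineq[OF qc rep] that sub by blast
  qed (use z K sub in \<open>auto intro: holomorphic_on_subset[OF h] holomorphic_on_subset[OF g]\<close>)
  then show ?thesis using w f[OF z] by simp
qed

text \<open>
  The speed is at most \<open>sqrt (K J r)\<close>, and \<open>J r\<close> is bounded by \<open>J s \<le> |h'(s \<zeta>)|\<^sup>2\<close> times the
  ratio of \<open>1 / s\<^sup>2 - 1\<close> to \<open>1 / r\<^sup>2 - 1\<close>.
\<close>

lemma ray_speed_bound:
  fixes h g :: "complex \<Rightarrow> complex"
  assumes h: "h holomorphic_on ball 0 1" and g: "g holomorphic_on ball 0 1"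
    and sr: "0 < s" "s \<le> r" "r < 1" and \<zeta>: "cmod \<zeta> = 1"
    and qc: "\<And>z. z \<in> ball 0 1 \<Longrightarrow>
       (cmod (deriv h z) + cmod (deriv g z))\<^sup>2 \<le> K * ((cmod (deriv h z))\<^sup>2 - (cmod (deriv g z))\<^sup>2)"
    and K: "K \<ge> 1"
    and P: "\<And>z. s \<le> cmod z \<Longrightarrow> cmod z \<le> r \<Longrightarrow> (1 - (cmod z)\<^sup>2) * Re (z * pre_Schwarzian h g z) \<le> 1"
  shows "cmod (deriv h (of_real r * \<zeta>)) + cmod (deriv g (of_real r * \<zeta>))
     \<le> sqrt K * cmod (deriv h (of_real s * \<zeta>)) * (sqrt (1 - s\<^sup>2) / s) * (r / sqrt (1 - r\<^sup>2))"
proof -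
  define J where "J \<rho> = (cmod (deriv h (of_real \<rho> * \<zeta>)))\<^sup>2 - (cmod (deriv g (of_real \<rho> * \<zeta>)))\<^sup>2" for \<rho>
  define T where "T = sqrt K * cmod (deriv h (of_real s * \<zeta>)) * (sqrt (1 - s\<^sup>2) / s) * (r / sqrt (1 - r\<^sup>2))"
  have r0: "r > 0" using sr by simp
  have r1: "r\<^sup>2 < 1" and s1: "s\<^sup>2 < 1" using sr by (auto simp: power_less_one_iff)
  have T0: "T \<ge> 0" unfolding T_def using K sr r0 r1 s1 by (intro mult_nonneg_nonneg) auto
  have T2: "T\<^sup>2 = K * ((cmod (deriv h (of_real s * \<zeta>)))\<^sup>2 * (1 / s\<^sup>2 - 1) * (r\<^sup>2 / (1 - r\<^sup>2)))"
  proof -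
    have "(sqrt (1 - s\<^sup>2) / s)\<^sup>2 = 1 / s\<^sup>2 - 1" using sr s1 by (simp add: power_divide diff_divide_distrib)
    moreover have "(r / sqrt (1 - r\<^sup>2))\<^sup>2 = r\<^sup>2 / (1 - r\<^sup>2)" using r1 by (simp add: power_divide)
    moreover have "(sqrt K)\<^sup>2 = K" using K by simp
    ultimately show ?thesis by (simp only: T_def power_mult_distrib mult.assoc)
  qed
  have rb: "of_real r * \<zeta> \<in> ball 0 1" using sr \<zeta> by (simp add: norm_mult)
  have "J r * (1 / r\<^sup>2 - 1) \<le> J s * (1 / s\<^sup>2 - 1)"
    unfolding J_def by (rule jacobian_ray_decay[OF h g \<zeta> sr qc K P])
  also have "\<dots> \<le> (cmod (deriv h (of_real s * \<zeta>)))\<^sup>2 * (1 / s\<^sup>2 - 1)"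
    using sr s1 by (intro mult_right_mono) (auto simp: J_def field_simps)
  finally have "J r * (1 / r\<^sup>2 - 1) * (r\<^sup>2 / (1 - r\<^sup>2))
      \<le> (cmod (deriv h (of_real s * \<zeta>)))\<^sup>2 * (1 / s\<^sup>2 - 1) * (r\<^sup>2 / (1 - r\<^sup>2))"
    using r1 by (intro mult_right_mono) auto
  moreover have "(1 / r\<^sup>2 - 1) * (r\<^sup>2 / (1 - r\<^sup>2)) = 1"
  proof -
    have "1 / r\<^sup>2 - 1 = (1 - r\<^sup>2) / r\<^sup>2" using r0 by (simp add: diff_divide_distrib)
    moreover have "1 - r\<^sup>2 \<noteq> 0" "r\<^sup>2 \<noteq> 0" using r0 r1 by auto
    ultimately show ?thesis by simp
  qed
  ultimately have Jr: "J r \<le> (cmod (deriv h (of_real s * \<zeta>)))\<^sup>2 * (1 / s\<^sup>2 - 1) * (r\<^sup>2 / (1 - r\<^sup>2))"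
    by (simp only: mult.assoc mult_1_right)
  have "(cmod (deriv h (of_real r * \<zeta>)) + cmod (deriv g (of_real r * \<zeta>)))\<^sup>2 \<le> K * J r"
    using qc[OF rb] by (simp add: J_def)
  also have "\<dots> \<le> T\<^sup>2" unfolding T2 using Jr K by (intro mult_left_mono) auto
  finally show ?thesis unfolding T_def[symmetric] using T0 by (rule power2_le_imp_le)
qed

theorem theorem5:
  fixes f h g :: "complex \<Rightarrow> complex" and K :: real
  assumes "K \<ge> 1"
    and "f \<in> S_H0"
    and "canonical_rep f h g"
    and "quasiconformal K f (ball 0 1) (f ` ball 0 1)"
    and "bounded (f ` ball 0 1)"
    and "Limsup (filtercomap norm (at_left 1))
           (\<lambda>z. ereal ((1 - (cmod z)\<^sup>2) * Re (z * pre_Schwarzian h g z))) < 1"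
    and "\<And>z. z \<in> ball 0 1 \<Longrightarrow> curve_length (radial_curve f z) 0 1 < \<infinity>"
  shows "radial_John_disk f"
proof -
  let ?G = "f ` ball 0 1"
  let ?\<delta> = "\<lambda>w. infdist w (frontier ?G)"
  have h: "h holomorphic_on ball 0 1" and g: "g holomorphic_on ball 0 1"
    and f: "\<And>z. z \<in> ball 0 1 \<Longrightarrow> f z = h z + cnj (g z)"
    using assms(3) by (auto simp: canonical_rep_def)
  have inj: "inj_on f (ball 0 1)" using assms(2) by (auto simp: S_H0_def S_H_def)
  obtain f' where hom: "homeomorphism (ball 0 1) ?G f f'" and "open ?G"
    using assms(4) by (auto simp: quasiconformal_def)
  then have contf: "continuous_on (ball 0 1) f" by (simp add: homeomorphism_def)
  have sc: "simply_connected ?G"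
    using homeomorphic_simply_connected_eq[of "ball 0 1" ?G] hom convex_imp_simply_connected[OF convex_ball]
    by (auto simp: homeomorphic_def)
  note qc = quasiconformal_deriv_ineq[OF assms(4,3)]
  have K: "sqrt K \<ge> 1" using assms(1) by simp
  have "eventually (\<lambda>z. ereal ((1 - (cmod z)\<^sup>2) * Re (z * pre_Schwarzian h g z)) < 1)
      (filtercomap norm (at_left 1))"
    using Limsup_lessD[OF assms(6)] .
  then obtain Q where Q: "eventually Q (at_left (1::real))"
    and QP: "\<And>z. Q (cmod z) \<Longrightarrow> (1 - (cmod z)\<^sup>2) * Re (z * pre_Schwarzian h g z) < 1"
    unfolding eventually_filtercomap by (auto simp: one_ereal_def)
  obtain b where b: "b < 1" and bQ: "\<And>y. b < y \<Longrightarrow> y < 1 \<Longrightarrow> Q y"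
    using Q unfolding eventually_at_left_field by blast
  \<comment> \<open>The lower bound \<open>1/2\<close> keeps \<open>s0\<close> positive, since it appears in denominators.\<close>
  define s0 where "s0 = max ((b + 1) / 2) (1 / 2)"
  have s0: "0 < s0" "s0 < 1" "b < s0" using b by (auto simp: s0_def max_def)
  have P: "(1 - (cmod z)\<^sup>2) * Re (z * pre_Schwarzian h g z) \<le> 1" if "s0 \<le> cmod z" "cmod z < 1" for z
    using QP[OF bQ] that s0 by (simp add: less_imp_le)
  have sub: "cball 0 s0 \<subseteq> ball (0::complex) 1" using s0 by auto

  \<comment> \<open>A bound for the speed on the whole disk, which makes all radial images uniformly short.\<close>
  have "compact ((\<lambda>z. cmod (deriv h z) + cmod (deriv g z)) ` cball 0 s0)"
  proof (intro compact_continuous_image compact_cball continuous_intros)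
    show "continuous_on (cball 0 s0) (deriv h)" "continuous_on (cball 0 s0) (deriv g)"
      by (intro holomorphic_on_imp_continuous_on holomorphic_on_subset[OF _ sub] holomorphic_deriv h g open_ball)+
  qed
  then have "bdd_above ((\<lambda>z. cmod (deriv h z) + cmod (deriv g z)) ` cball 0 s0)"
    by (intro bounded_imp_bdd_above compact_imp_bounded)
  then obtain C where C: "\<And>z. z \<in> cball 0 s0 \<Longrightarrow> cmod (deriv h z) + cmod (deriv g z) \<le> C"
    unfolding bdd_above_def ball_simps by blast
  have "0 \<le> cmod (deriv h 0) + cmod (deriv g 0)" by simp
  also have "\<dots> \<le> C" using s0 by (intro C) simp
  finally have C0: "C \<ge> 0" .

  define C2 where "C2 = sqrt K * C * (sqrt (1 - s0\<^sup>2) / s0)"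
  have C20: "C2 \<ge> 0" unfolding C2_def using K C0 s0 by (intro mult_nonneg_nonneg) (auto simp: power_le_one)
  have speed: "cmod (deriv h z) + cmod (deriv g z) \<le> C + C2 * (cmod z / sqrt (1 - (cmod z)\<^sup>2))"
    if z: "z \<in> ball 0 1" for z
  proof (cases "cmod z \<le> s0")
    case True
    have "0 \<le> C2 * (cmod z / sqrt (1 - (cmod z)\<^sup>2))"
      using C20 z by (intro mult_nonneg_nonneg) (auto simp: power_le_one)
    then show ?thesis using C[of z] True by simp
  next
    case False
    define \<zeta> where "\<zeta> = sgn z"
    have z0: "z \<noteq> 0" using False s0 by auto
    then have \<zeta>: "cmod \<zeta> = 1" by (simp add: \<zeta>_def norm_sgn)
    have zz: "z = of_real (cmod z) * \<zeta>" using z0 by (simp add: \<zeta>_def sgn_eq)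
    have "cmod (deriv h (of_real (cmod z) * \<zeta>)) + cmod (deriv g (of_real (cmod z) * \<zeta>))
       \<le> sqrt K * cmod (deriv h (of_real s0 * \<zeta>)) * (sqrt (1 - s0\<^sup>2) / s0) * (cmod z / sqrt (1 - (cmod z)\<^sup>2))"
      by (rule ray_speed_bound[OF h g s0(1) _ _ \<zeta> qc assms(1)]) (use False z P in auto)
    also have "\<dots> \<le> C2 * (cmod z / sqrt (1 - (cmod z)\<^sup>2))"
      unfolding C2_def
    proof (intro mult_right_mono mult_left_mono)
      have "cmod (deriv h (of_real s0 * \<zeta>)) + cmod (deriv g (of_real s0 * \<zeta>)) \<le> C"
        using s0 \<zeta> by (intro C) (simp add: norm_mult)
      then show "cmod (deriv h (of_real s0 * \<zeta>)) \<le> C"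
        using norm_ge_zero[of "deriv g (of_real s0 * \<zeta>)"] by linarith
    qed (use K s0 z in \<open>auto simp: power_le_one\<close>)
    finally show ?thesis using C0 zz by simp
  qed
  have lens: "curve_length (radial_curve f z1) a 1 \<le> ennreal (C + C2)"
    if "z1 \<in> ball 0 1" "a \<in> {0..1}" for z1 a
  proof -
    have mem: "of_real \<tau> * z1 \<in> ball 0 1" if "a \<le> \<tau>" "\<tau> \<le> 1" for \<tau>
      using \<open>z1 \<in> ball 0 1\<close> \<open>a \<in> {0..1}\<close> that mult_left_le_one_le[of "cmod z1" "\<tau>"] by (simp add: norm_mult)
    have "curve_length (radial_curve f z1) a 1
      \<le> ennreal (C * ((1 - a) * cmod z1) + C2 * (sqrt (1 - (a * cmod z1)\<^sup>2) - sqrt (1 - (cmod z1)\<^sup>2)))"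
    proof (rule radial_length_le[OF h g f that(1)])
      fix \<tau> assume \<tau>: "a \<le> \<tau>" "\<tau> \<le> 1"
      then have "cmod (of_real \<tau> * z1) = \<tau> * cmod z1" using that by (simp add: norm_mult)
      then show "cmod (deriv h (of_real \<tau> * z1)) + cmod (deriv g (of_real \<tau> * z1))
          \<le> C + C2 * (\<tau> * cmod z1 / sqrt (1 - (\<tau> * cmod z1)\<^sup>2))"
        using speed[OF mem[OF \<tau>]] by simp
    qed (use that in auto)
    also have "\<dots> \<le> ennreal (C * 1 + C2 * 1)"
    proof (intro ennreal_leI add_mono mult_left_mono)
      show "(1 - a) * cmod z1 \<le> 1" using that by (intro mult_le_one) auto
      have "sqrt (1 - (a * cmod z1)\<^sup>2) \<le> 1" by simp
      moreover have "0 \<le> sqrt (1 - (cmod z1)\<^sup>2)" using that by (simp add: power_le_one)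
      ultimately show "sqrt (1 - (a * cmod z1)\<^sup>2) - sqrt (1 - (cmod z1)\<^sup>2) \<le> 1" by linarith
    qed (use C0 C20 in auto)
    finally show ?thesis by simp
  qed

  \<comment> \<open>The images of the points with \<open>|z| \<le> s0\<close> stay at distance at least \<open>\<epsilon>\<close> from the boundary.\<close>
  have frne: "frontier ?G \<noteq> {}"
    using assms(5) not_bounded_UNIV frontier_eq_empty[of ?G] by (metis centre_in_ball empty_iff image_is_empty zero_less_one)
  have "\<exists>z\<in>cball 0 s0. \<forall>y\<in>cball 0 s0. ?\<delta> (f z) \<le> ?\<delta> (f y)"
    by (intro continuous_attains_inf compact_cball continuous_intros continuous_on_subset[OF contf sub])
       (use s0 in auto)
  then obtain zm where zm: "zm \<in> cball 0 s0" and min: "\<And>y. y \<in> cball 0 s0 \<Longrightarrow> ?\<delta> (f zm) \<le> ?\<delta> (f y)"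
    by blast
  define \<epsilon> where "\<epsilon> = ?\<delta> (f zm)"
  have "f zm \<in> ?G" using zm sub by blast
  then have "f zm \<notin> frontier ?G" using \<open>open ?G\<close> by (simp add: frontier_def interior_open)
  then have \<epsilon>: "\<epsilon> > 0" unfolding \<epsilon>_def using infdist_pos_not_in_closed[OF frontier_closed frne] by blast

  define c where "c = max 1 (max ((C + C2) / \<epsilon>) (2 * sqrt K * koebe_const K / s0))"
  have main: "curve_length (radial_curve f z1) t 1 \<le> ennreal (c * ?\<delta> (radial_curve f z1 t))"
    if z1: "z1 \<in> ball 0 1" and t: "t \<in> {0..1}" for z1 t
  proof (cases "t * cmod z1 \<le> s0")
    case True
    then have "of_real t * z1 \<in> cball 0 s0" using t by (simp add: norm_mult)
    then have "\<epsilon> \<le> ?\<delta> (radial_curve f z1 t)" unfolding \<epsilon>_def radial_curve_def by (rule min)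
    then have "C + C2 \<le> (C + C2) / \<epsilon> * ?\<delta> (radial_curve f z1 t)"
      using \<epsilon> C0 C20 by (simp add: field_simps add_mono mult_left_mono)
    also have "\<dots> \<le> c * ?\<delta> (radial_curve f z1 t)"
      by (intro mult_right_mono) (auto simp: c_def infdist_nonneg)
    finally show ?thesis using lens[OF z1 t] order_trans ennreal_leI by blast
  next
    case False
    define w where "w = of_real t * z1"
    define s where "s = cmod w"
    have sw: "s = t * cmod z1" using t by (simp add: s_def w_def norm_mult)
    have "s \<le> 1 * cmod z1" unfolding sw using t by (intro mult_right_mono) auto
    then have s: "s0 < s" "s < 1" using False sw z1 by auto
    have s1: "s\<^sup>2 < 1" using s s0 by (simp add: power_less_one_iff)
    have wb: "w \<in> ball 0 1" using s by (simp add: s_def)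
    define \<zeta> where "\<zeta> = sgn z1"
    have z10: "z1 \<noteq> 0" using s sw s0 by auto
    then have \<zeta>: "cmod \<zeta> = 1" by (simp add: \<zeta>_def norm_sgn)
    have zz: "z1 = of_real (cmod z1) * \<zeta>" using z10 by (simp add: \<zeta>_def sgn_eq)
    have ray: "of_real \<tau> * z1 = of_real (\<tau> * cmod z1) * \<zeta>" for \<tau>
      by (subst zz) (simp add: mult.assoc)
    \<comment> \<open>The constant of \<open>ray_speed_bound\<close> for the ray beyond \<open>w\<close>. Integration turns it into a bound
      \<open>D sqrt (1 - s\<^sup>2)\<close> for the length, which is comparable to \<open>(1 - s) |h' w|\<close>.\<close>
    define D where "D = sqrt K * cmod (deriv h w) * (sqrt (1 - s\<^sup>2) / s)"
    have D0: "D \<ge> 0" unfolding D_def using K s s0 s1 by (intro mult_nonneg_nonneg) auto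
    have "curve_length (radial_curve f z1) t 1
      \<le> ennreal (0 * ((1 - t) * cmod z1) + D * (sqrt (1 - (t * cmod z1)\<^sup>2) - sqrt (1 - (cmod z1)\<^sup>2)))"
    proof (rule radial_length_le[OF h g f z1])
      fix \<tau> assume \<tau>: "t \<le> \<tau>" "\<tau> \<le> 1"
      have le: "s \<le> \<tau> * cmod z1" unfolding sw using \<tau> by (intro mult_right_mono) auto
      have "\<tau> * cmod z1 \<le> 1 * cmod z1" using \<tau> by (intro mult_right_mono) auto
      then have lt: "\<tau> * cmod z1 < 1" using z1 by simp
      have "cmod (deriv h (of_real (\<tau> * cmod z1) * \<zeta>)) + cmod (deriv g (of_real (\<tau> * cmod z1) * \<zeta>))
        \<le> sqrt K * cmod (deriv h (of_real s * \<zeta>)) * (sqrt (1 - s\<^sup>2) / s)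
            * ((\<tau> * cmod z1) / sqrt (1 - (\<tau> * cmod z1)\<^sup>2))"
        by (rule ray_speed_bound[OF h g _ le lt \<zeta> qc assms(1)]) (use s s0 lt P in auto)
      moreover have "of_real s * \<zeta> = w" unfolding w_def ray sw ..
      ultimately show "cmod (deriv h (of_real \<tau> * z1)) + cmod (deriv g (of_real \<tau> * z1))
          \<le> 0 + D * (\<tau> * cmod z1 / sqrt (1 - (\<tau> * cmod z1)\<^sup>2))"
        unfolding ray D_def by simp
    qed (use t in auto)
    also have "\<dots> \<le> ennreal (c * ?\<delta> (radial_curve f z1 t))"
    proof (rule ennreal_leI)
      have "0 * ((1 - t) * cmod z1) + D * (sqrt (1 - (t * cmod z1)\<^sup>2) - sqrt (1 - (cmod z1)\<^sup>2))
          \<le> D * sqrt (1 - s\<^sup>2)"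
        using D0 z1 unfolding sw by (simp add: mult_left_mono power_le_one)
      also have "\<dots> = sqrt K * cmod (deriv h w) * ((1 - s\<^sup>2) / s)"
        using s1 by (simp add: D_def)
      also have "(1 - s\<^sup>2) / s \<le> 2 * (1 - s) / s0"
      proof (rule frac_le)
        have "1 - s\<^sup>2 = (1 + s) * (1 - s)" by (simp add: power2_eq_square algebra_simps)
        also have "\<dots> \<le> 2 * (1 - s)" using s by (intro mult_right_mono) auto
        finally show "1 - s\<^sup>2 \<le> 2 * (1 - s)" .
      qed (use s s0 in auto)
      then have "sqrt K * cmod (deriv h w) * ((1 - s\<^sup>2) / s) \<le> sqrt K * cmod (deriv h w) * (2 * (1 - s) / s0)"
        using K by (intro mult_left_mono) auto
      also have "\<dots> = 2 * sqrt K / s0 * ((1 - cmod w) * cmod (deriv h w))" by (simp add: s_def)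
      also have "\<dots> \<le> 2 * sqrt K / s0 * (koebe_const K * ?\<delta> (f w))"
        using norm_deriv_le_infdist[OF assms(3,4) inj assms(5) wb] K s0 by (intro mult_left_mono) auto
      also have "\<dots> = 2 * sqrt K * koebe_const K / s0 * ?\<delta> (f w)" by simp
      also have "\<dots> \<le> c * ?\<delta> (f w)"
        by (intro mult_right_mono) (auto simp: c_def infdist_nonneg)
      finally show "0 * ((1 - t) * cmod z1) + D * (sqrt (1 - (t * cmod z1)\<^sup>2) - sqrt (1 - (cmod z1)\<^sup>2))
          \<le> c * ?\<delta> (radial_curve f z1 t)"
        by (simp add: radial_curve_def w_def)
    qed
    finally show ?thesis .
  qed
  have "radial_c_John_disk c f"
    unfolding radial_c_John_disk_def using contf inj assms(5,7) sc main by (auto simp: c_def)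
  then show ?thesis unfolding radial_John_disk_def ..
qed

end
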